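(* Let $d\ge 2$ and let $\bm X:\Omega\to\mathbb R^d$ be a random variable on a probability space $(\Omega,\mathcal A,P)$ whose distribution has a smooth density function $p_{\bm X}$, where $\operatorname{supp} p_{\bm X}=\mathbb X$ is a compact region in $\mathbb R^d$ and $p_{\bm X}$ is strictly positive in the interior of $\mathbb X$. Let $\Gamma:[0,\ell_\Gamma]\to\mathbb X$ be a smooth Jordan curve parameterized by arc-length, with a smooth orthonormal moving frame $T=\Gamma',N_1,\dots,N_{d-1}$, such that the normal coordinate map $\nu_\Gamma$ is a diffeomorphism on $(\lambda_\Gamma^{-1}([0,\ell_\Gamma])\cap\mathbb X)\setminus\mathcal A_\Gamma$. Then $\Gamma$ is self-consistent with respect to $\bm X$ if and only if its principal curvatures $\kappa_1,\dots,\kappa_{d-1}$ fulfill the linear system of equations $$\bm\mu(s)=\bm G(s)\,\big(\kappa_1(s),\dots,\kappa_{d-1}(s)\big)^{\mathrm T},\qquad s\in[0,\ell_\Gamma],$$ where $$\bm G(s):=\big(\mu_{\bm e_i+\bm e_j}(s)\big)_{i,j=1}^{d-1},\qquad \bm\mu(s):=\big(\mu_{\bm e_i}(s)\big)_{i=1}^{d-1},$$ $\mu_{\bm j}(s)$ are the transverse moments, and $\bm e_1,\dots,\bm e_{d-1}$ is the canonical basis of $\mathbb R^{d-1}$. The Gram matrix $\bm G(s)$ is invertible, so that the linear system is equivalent to $\kappa_j=(\bm G^{-1}\bm\mu)_j$, $j=1,\dots,d-1$.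
   Context: Curves: a smooth Jordan curve parameterized by arc-length is an injective map $\Gamma\in C^\infty([0,\ell_\Gamma],\mathbb R^d)$ with $\|\Gamma'(s)\|=1$ for all $s$ (Euclidean norm). Projection: $\bm x\in\mathbb R^d$ is an ambiguity point of $\Gamma$ if it has more than one closest point on $\Gamma$; $\mathcal A_\Gamma$ is the set of ambiguity points. The projection index is $\lambda_\Gamma(\bm x):=\sup\{s\in[0,\ell_\Gamma]:\|\bm x-\Gamma(s)\|=\inf_{t\in[0,\ell_\Gamma]}\|\bm x-\Gamma(t)\|\}$, and $\pi_\Gamma:=\Gamma\circ\lambda_\Gamma$. Self-consistency: $\Gamma$ is self-consistent with respect to $\bm X$ if $\mathbb E[\bm X\mid\lambda_\Gamma(\bm X)=s]=\Gamma(s)$ for $P_{\lambda_\Gamma(\bm X)}$-almost every $s\in[0,\ell_\Gamma]$, where $P_{\lambda_\Gamma(\bm X)}$ is the distribution of $\lambda_\Gamma(\bm X)$. Frame and principal curvatures: $T(s):=\Gamma'(s)$, and $N_1(s),\dots,N_{d-1}(s)$ are unit, pairwise orthogonal vectors spanning the normal space of $\Gamma$ at $s$, depending smoothly on $s$. The principal curvatures with respect to this frame are $\kappa_i(s):=\langle T'(s),N_i(s)\rangle$, $i=1,\dots,d-1$. Normal coordinates: the normal coordinate map is $\nu_\Gamma:[0,\ell_\Gamma]\times\mathbb R^{d-1}\to\mathbb R^d$, $\nu_\Gamma(s,u_1,\dots,u_{d-1}):=\Gamma(s)+\sum_{i=1}^{d-1}u_iN_i(s)$, and the normal coordinate transformation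 is $\mu_\Gamma:\mathbb X\to[0,\ell_\Gamma]\times\mathbb R^{d-1}$, $\mu_\Gamma(\bm x):=\big(\lambda_\Gamma(\bm x),\langle\bm x-\pi_\Gamma(\bm x),N_1(\lambda_\Gamma(\bm x))\rangle,\dots,\langle\bm x-\pi_\Gamma(\bm x),N_{d-1}(\lambda_\Gamma(\bm x))\rangle\big)$. That $\nu_\Gamma$ is a diffeomorphism on $S:=(\lambda_\Gamma^{-1}([0,\ell_\Gamma])\cap\mathbb X)\setminus\mathcal A_\Gamma$ means that $\nu_\Gamma\circ\mu_\Gamma=\mathrm{id}$ on $S$ and that $\mu_\Gamma$ and $\nu_\Gamma$ are differentiable on the related domains $S$ and $\mu_\Gamma(S)$ (so that $\nu_\Gamma:\mu_\Gamma(S)\to S$ is a diffeomorphism with inverse $\mu_\Gamma$). Transverse moments: for $s\in[0,\ell_\Gamma]$ let $\mathcal R(s)$ be the set of $\bm u=(u_1,\dots,u_{d-1})\in\mathbb R^{d-1}$ such that $\lambda_\Gamma\big(\Gamma(s)+\sum_iu_iN_i(s)\big)=s$ and $\Gamma(s)+\sum_iu_iN_i(s)\notin\mathcal A_\Gamma$. For $\bm j\in\mathbb N_0^{d-1}$, $$\mu_{\bm j}(s):=\int_{\mathcal R(s)}u_1^{j_1}\cdots u_{d-1}^{j_{d-1}}\,p_{\bm X}\Big(\Gamma(s)+\sum_{i=1}^{d-1}u_iN_i(s)\Big)\,d\bm u.$$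
   Formalization: Invertibility of G(s) and the form κ = G⁻¹μ are claimed only for s whose normal slice meets the interior of 𝕏, and for P_λ(X)-almost every s; elsewhere, e.g. at the end points of a disc's diameter, p vanishes on the slice and G(s) = 0. *)

theory Defs
  imports "HOL-Probability.Probability"
begin

text \<open>Curves are functions \<open>\<Gamma>\<close> on the reals of which only the values on \<open>{0..l}\<close> matter. The
  normal vectors \<open>N i s\<close> are indexed by a finite type \<open>'n\<close> with \<open>d - 1\<close> elements, and
  \<open>real ^ 'n\<close> is the space of normal coordinates.\<close>

subsection \<open>Smoothness\<close>

primrec Ck :: "nat \<Rightarrow> ('a::euclidean_space \<Rightarrow> real) \<Rightarrow> bool" where
  "Ck 0 f \<longleftrightarrow> continuous_on UNIV f"
| "Ck (Suc k) f \<longleftrightarrow>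
     (\<forall>x. f differentiable (at x)) \<and> (\<forall>b\<in>Basis. Ck k (\<lambda>x. frechet_derivative f (at x) b))"

definition smooth :: "('a::euclidean_space \<Rightarrow> real) \<Rightarrow> bool" where
  "smooth f \<longleftrightarrow> (\<forall>k. Ck k f)"

text \<open>On the compact interval \<open>{0..l}\<close> the derivatives at the end points are one-sided; \<open>D k\<close>
  is the \<open>k\<close>-th derivative.\<close>

definition smooth_path :: "real \<Rightarrow> (real \<Rightarrow> 'a::real_normed_vector) \<Rightarrow> bool" where
  "smooth_path l f \<longleftrightarrow>
     (\<exists>D. D 0 = f \<and>
        (\<forall>k. \<forall>s\<in>{0..l}. (D k has_vector_derivative D (Suc k) s) (at s within {0..l})))"

subsection \<open>Regions and supports\<close>

definition compact_region :: "'a::euclidean_space set \<Rightarrow> bool" where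
  "compact_region K \<longleftrightarrow>
     compact K \<and> (\<exists>U. open U \<and> connected U \<and> U \<noteq> {} \<and> K = closure U)"

definition support :: "('a::euclidean_space \<Rightarrow> real) \<Rightarrow> 'a set" where
  "support f = closure {x. f x \<noteq> 0}"

subsection \<open>Curves, projection and self-consistency\<close>

definition unit_tangent :: "(real \<Rightarrow> real ^ 'd) \<Rightarrow> real \<Rightarrow> real \<Rightarrow> real ^ 'd" where
  "unit_tangent \<Gamma> l s = vector_derivative \<Gamma> (at s within {0..l})"

definition smooth_jordan_curve :: "(real \<Rightarrow> real ^ 'd) \<Rightarrow> real \<Rightarrow> bool" where
  "smooth_jordan_curve \<Gamma> l \<longleftrightarrow>
     0 < l \<and> smooth_path l \<Gamma> \<and> inj_on \<Gamma> {0..l} \<and> (\<forall>s\<in>{0..l}. norm (unit_tangent \<Gamma> l s) = 1)"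

definition closest_params :: "(real \<Rightarrow> real ^ 'd) \<Rightarrow> real \<Rightarrow> real ^ 'd \<Rightarrow> real set" where
  "closest_params \<Gamma> l x = {s \<in> {0..l}. norm (x - \<Gamma> s) = (INF t\<in>{0..l}. norm (x - \<Gamma> t))}"

definition ambiguity_points :: "(real \<Rightarrow> real ^ 'd) \<Rightarrow> real \<Rightarrow> (real ^ 'd) set" where
  "ambiguity_points \<Gamma> l =
     {x. \<exists>y \<in> \<Gamma> ` closest_params \<Gamma> l x. \<exists>z \<in> \<Gamma> ` closest_params \<Gamma> l x. y \<noteq> z}"

definition projection_index :: "(real \<Rightarrow> real ^ 'd) \<Rightarrow> real \<Rightarrow> real ^ 'd \<Rightarrow> real" where
  "projection_index \<Gamma> l x = Sup (closest_params \<Gamma> l x)"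

definition projection :: "(real \<Rightarrow> real ^ 'd) \<Rightarrow> real \<Rightarrow> real ^ 'd \<Rightarrow> real ^ 'd" where
  "projection \<Gamma> l x = \<Gamma> (projection_index \<Gamma> l x)"

text \<open>\<open>g\<close> is a version of \<open>s \<mapsto> E[X | Y = s]\<close>, i.e. a Borel function such that \<open>g \<circ> Y\<close> is,
  componentwise, the conditional expectation of \<open>X\<close> given the sigma-algebra generated by \<open>Y\<close>.\<close>

definition cond_exp_version ::
  "'w measure \<Rightarrow> ('w \<Rightarrow> real ^ 'd) \<Rightarrow> ('w \<Rightarrow> real) \<Rightarrow> (real \<Rightarrow> real ^ 'd) \<Rightarrow> bool" where
  "cond_exp_version M X Y g \<longleftrightarrow>
     g \<in> borel_measurable borel \<and>
     (\<forall>i. AE w in M. real_cond_exp M (vimage_algebra (space M) Y borel) (\<lambda>w. X w $ i) w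
                       = g (Y w) $ i)"

definition self_consistent ::
  "'w measure \<Rightarrow> ('w \<Rightarrow> real ^ 'd) \<Rightarrow> (real \<Rightarrow> real ^ 'd) \<Rightarrow> real \<Rightarrow> bool" where
  "self_consistent M X \<Gamma> l \<longleftrightarrow>
     (\<exists>g. cond_exp_version M X (\<lambda>w. projection_index \<Gamma> l (X w)) g \<and>
          (AE s in distr M borel (\<lambda>w. projection_index \<Gamma> l (X w)). g s = \<Gamma> s))"

subsection \<open>Frames and normal coordinates\<close>

definition moving_frame ::
  "(real \<Rightarrow> real ^ 'd) \<Rightarrow> real \<Rightarrow> ('n::finite \<Rightarrow> real \<Rightarrow> real ^ 'd) \<Rightarrow> bool" where
  "moving_frame \<Gamma> l N \<longleftrightarrow>
     (\<forall>i. smooth_path l (N i)) \<and>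
     (\<forall>s\<in>{0..l}. (\<forall>i. norm (N i s) = 1) \<and>
        (\<forall>i j. i \<noteq> j \<longrightarrow> N i s \<bullet> N j s = 0) \<and>
        span (range (\<lambda>i. N i s)) = {v. v \<bullet> unit_tangent \<Gamma> l s = 0})"

definition principal_curvatures ::
  "(real \<Rightarrow> real ^ 'd) \<Rightarrow> real \<Rightarrow> ('n::finite \<Rightarrow> real \<Rightarrow> real ^ 'd) \<Rightarrow> real \<Rightarrow> real ^ 'n" where
  "principal_curvatures \<Gamma> l N s =
     (\<chi> i. vector_derivative (unit_tangent \<Gamma> l) (at s within {0..l}) \<bullet> N i s)"

definition normal_coord_map ::
  "(real \<Rightarrow> real ^ 'd) \<Rightarrow> ('n::finite \<Rightarrow> real \<Rightarrow> real ^ 'd) \<Rightarrow> real \<times> (real ^ 'n) \<Rightarrow> real ^ 'd" where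
  "normal_coord_map \<Gamma> N = (\<lambda>(s, u). \<Gamma> s + (\<Sum>i\<in>UNIV. (u $ i) *\<^sub>R N i s))"

definition normal_coord_transform ::
  "(real \<Rightarrow> real ^ 'd) \<Rightarrow> real \<Rightarrow> ('n::finite \<Rightarrow> real \<Rightarrow> real ^ 'd) \<Rightarrow> real ^ 'd \<Rightarrow> real \<times> (real ^ 'n)" where
  "normal_coord_transform \<Gamma> l N x =
     (projection_index \<Gamma> l x,
      \<chi> i. (x - projection \<Gamma> l x) \<bullet> N i (projection_index \<Gamma> l x))"

definition normal_coords_diffeo_on ::
  "(real \<Rightarrow> real ^ 'd) \<Rightarrow> real \<Rightarrow> ('n::finite \<Rightarrow> real \<Rightarrow> real ^ 'd) \<Rightarrow> (real ^ 'd) set \<Rightarrow> bool" where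
  "normal_coords_diffeo_on \<Gamma> l N S \<longleftrightarrow>
     (\<forall>x\<in>S. normal_coord_map \<Gamma> N (normal_coord_transform \<Gamma> l N x) = x) \<and>
     normal_coord_transform \<Gamma> l N differentiable_on S \<and>
     normal_coord_map \<Gamma> N differentiable_on (normal_coord_transform \<Gamma> l N ` S)"

subsection \<open>Transverse moments\<close>

definition transverse_range ::
  "(real \<Rightarrow> real ^ 'd) \<Rightarrow> real \<Rightarrow> ('n::finite \<Rightarrow> real \<Rightarrow> real ^ 'd) \<Rightarrow> real \<Rightarrow> (real ^ 'n) set" where
  "transverse_range \<Gamma> l N s =
     {u. projection_index \<Gamma> l (normal_coord_map \<Gamma> N (s, u)) = s \<and>
         normal_coord_map \<Gamma> N (s, u) \<notin> ambiguity_points \<Gamma> l}"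

definition transverse_moment ::
  "(real ^ 'd \<Rightarrow> real) \<Rightarrow> (real \<Rightarrow> real ^ 'd) \<Rightarrow> real \<Rightarrow> ('n::finite \<Rightarrow> real \<Rightarrow> real ^ 'd) \<Rightarrow>
     ('n \<Rightarrow> nat) \<Rightarrow> real \<Rightarrow> real" where
  "transverse_moment p \<Gamma> l N j s =
     (LINT u : transverse_range \<Gamma> l N s | lborel.
        (\<Prod>i\<in>UNIV. (u $ i) ^ j i) * p (normal_coord_map \<Gamma> N (s, u)))"

definition unit_index :: "'n \<Rightarrow> 'n \<Rightarrow> nat" where
  "unit_index i = (\<lambda>k. if k = i then 1 else 0)"

definition moment_vector ::
  "(real ^ 'd \<Rightarrow> real) \<Rightarrow> (real \<Rightarrow> real ^ 'd) \<Rightarrow> real \<Rightarrow> ('n::finite \<Rightarrow> real \<Rightarrow> real ^ 'd) \<Rightarrow>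
     real \<Rightarrow> real ^ 'n" where
  "moment_vector p \<Gamma> l N s = (\<chi> i. transverse_moment p \<Gamma> l N (unit_index i) s)"

definition gram_matrix ::
  "(real ^ 'd \<Rightarrow> real) \<Rightarrow> (real \<Rightarrow> real ^ 'd) \<Rightarrow> real \<Rightarrow> ('n::finite \<Rightarrow> real \<Rightarrow> real ^ 'd) \<Rightarrow>
     real \<Rightarrow> real ^ 'n ^ 'n" where
  "gram_matrix p \<Gamma> l N s =
     (\<chi> i j. transverse_moment p \<Gamma> l N (\<lambda>k. unit_index i k + unit_index j k) s)"

text \<open>The normal slice at \<open>s\<close> meets the interior of \<open>K\<close>. Every \<open>s\<close> for which \<open>\<Gamma> s\<close> is an
  interior point of \<open>K\<close> has this property (take \<open>u = 0\<close>). If \<open>K\<close> is the support of a continuous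
  density and the slice misses the interior, then the density vanishes on the whole slice, so all
  transverse moments at \<open>s\<close> are zero and the Gram matrix is singular. When the normal coordinates
  are a diffeomorphism as assumed in the theorem, this happens at the end points \<open>s = 0\<close> and
  \<open>s = l\<close>: otherwise points near the slice and beyond the end of the curve would project to the end
  point without lying in its normal space. The diameter of a disc is an example.\<close>

definition nondegenerate_slice ::
  "(real ^ 'd) set \<Rightarrow> (real \<Rightarrow> real ^ 'd) \<Rightarrow> real \<Rightarrow> ('n::finite \<Rightarrow> real \<Rightarrow> real ^ 'd) \<Rightarrow> real \<Rightarrow> bool" where
  "nondegenerate_slice K \<Gamma> l N s \<longleftrightarrow>
     (\<exists>u \<in> transverse_range \<Gamma> l N s. normal_coord_map \<Gamma> N (s, u) \<in> interior K)"

end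

theory Submission
  imports Defs
begin

text \<open>In normal coordinates \<open>x = \<nu>(s, u)\<close> Lebesgue measure is \<open>(1 - u \<bullet> \<kappa>(s)) du ds\<close>, since
  \<open>\<langle>N\<^sub>i', T\<rangle> = - \<kappa>\<^sub>i\<close>, and the Jacobian is nonnegative on the slices by the second-order condition for
  a closest point. Hence the integral of \<open>X - \<pi>(X)\<close> over \<open>\<lambda>(X) \<in> B\<close> is the integral over
  \<open>s \<in> B\<close> of \<open>\<Sum>\<^sub>i (\<mu> - G \<kappa>)\<^sub>i(s) N\<^sub>i(s)\<close>, and self-consistency says that this vector vanishes for
  almost every \<open>s\<close>. It is continuous on the open parameter interval: for almost every \<open>u\<close> the point
  \<open>\<nu>(s, u)\<close> is neither focal (a hyperplane in \<open>u\<close>) nor ambiguous with \<open>s\<close> among its closest parameters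
  (a set met at most once by each ray), and at other points membership in the slice is locally constant
  in \<open>s\<close>. So it vanishes for every \<open>s\<close>. At the end points it vanishes
  anyway, because points of the interior of \<open>K\<close> beyond an end of the curve would project to the end point
  without lying in its normal space. The Gram matrix is positive definite because a slice that
  meets the interior of \<open>K\<close> contains an open set on which the density is positive.\<close>

section \<open>Framed curves and their closest-point projection\<close>

text \<open>The slices are cut out by a global minimisation and nothing is known about their
  boundaries, so two facts carry the argument. The graph of closest parameters is closed: closest
  parameters vary upper semicontinuously, and not being one is an open condition. And
  \<open>tangential x t\<close>, which is -1/2 times the t-derivative of the squared distance, has
  derivative \<open>- focal x t\<close>, where \<open>focal (nu s u) s = jac s u\<close>. Where the
  Jacobian is positive, \<open>tangential\<close> is thus strictly decreasing in t, uniformly for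
  nearby points, and has at most one zero. This keeps a regular point of a slice inside the
  neighbouring slices, and the sign of \<open>tangential\<close> beyond an end of the curve keeps
  the end slices out of the interior of \<open>K\<close>. Normality of the residual is taken from
  the identity of normal coordinates, because at an end point minimality alone gives only an
  inequality. Ambiguity points are shown to be null twice, in space and within each normal
  hyperplane, since a hyperplane is itself a null set of space.\<close>

locale framed_curve =
  fixes \<Gamma> T dT :: "real \<Rightarrow> real ^ 'd" and l :: real and N dN :: "'n::finite \<Rightarrow> real \<Rightarrow> real ^ 'd"
  assumes l_pos: "0 < l"
    and deriv_curve: "\<And>s. s \<in> {0..l} \<Longrightarrow> (\<Gamma> has_vector_derivative T s) (at s within {0..l})"
    and deriv_T: "\<And>s. s \<in> {0..l} \<Longrightarrow> (T has_vector_derivative dT s) (at s within {0..l})"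
    and cont_dT: "continuous_on {0..l} dT"
    and deriv_N: "\<And>i s. s \<in> {0..l} \<Longrightarrow> (N i has_vector_derivative dN i s) (at s within {0..l})"
    and inj: "inj_on \<Gamma> {0..l}"
    and norm_T: "\<And>s. s \<in> {0..l} \<Longrightarrow> norm (T s) = 1"
    and norm_N: "\<And>i s. s \<in> {0..l} \<Longrightarrow> norm (N i s) = 1"
    and N_orth: "\<And>i j s. s \<in> {0..l} \<Longrightarrow> i \<noteq> j \<Longrightarrow> N i s \<bullet> N j s = 0"
    and N_T: "\<And>i s. s \<in> {0..l} \<Longrightarrow> N i s \<bullet> T s = 0"
    and N_span: "\<And>v s. s \<in> {0..l} \<Longrightarrow> v \<bullet> T s = 0 \<Longrightarrow> v \<in> span (range (\<lambda>i. N i s))"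
    and dim_eq: "CARD('d) = Suc CARD('n)"
begin

abbreviation cp :: "real ^ 'd \<Rightarrow> real set" where "cp \<equiv> closest_params \<Gamma> l"
abbreviation index :: "real ^ 'd \<Rightarrow> real" where "index \<equiv> projection_index \<Gamma> l"
abbreviation amb :: "(real ^ 'd) set" where "amb \<equiv> ambiguity_points \<Gamma> l"
abbreviation slice :: "real \<Rightarrow> (real ^ 'n) set" where "slice \<equiv> transverse_range \<Gamma> l N"

definition offset :: "real \<Rightarrow> real ^ 'n \<Rightarrow> real ^ 'd" where
  "offset s u = (\<Sum>i\<in>UNIV. (u $ i) *\<^sub>R N i s)"

definition nu :: "real \<Rightarrow> real ^ 'n \<Rightarrow> real ^ 'd" where
  "nu s u = \<Gamma> s + offset s u"

definition kappa :: "real \<Rightarrow> real ^ 'n" where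
  "kappa s = (\<chi> i. dT s \<bullet> N i s)"

definition jac :: "real \<Rightarrow> real ^ 'n \<Rightarrow> real" where
  "jac s u = 1 - u \<bullet> kappa s"

text \<open>Up to the factor -2 the derivative of the squared distance from x to the curve; its
  zeros are the parameters whose normal space contains x.\<close>

definition tangential :: "real ^ 'd \<Rightarrow> real \<Rightarrow> real" where
  "tangential x t = (x - \<Gamma> t) \<bullet> T t"

text \<open>Half the second derivative of the squared distance in t. At a point of the normal space
  it vanishes exactly on the focal set.\<close>

definition focal :: "real ^ 'd \<Rightarrow> real \<Rightarrow> real" where
  "focal x t = 1 - (x - \<Gamma> t) \<bullet> dT t"

section \<open>Frame coordinates and derivatives of the squared distance\<close>

lemma normal_coord_map_nu: "normal_coord_map \<Gamma> N (s, u) = nu s u"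
  by (simp add: normal_coord_map_def nu_def offset_def)

lemma cont_curve: "continuous_on {0..l} \<Gamma>"
  using deriv_curve has_vector_derivative_continuous continuous_on_eq_continuous_within by blast

lemma cont_T: "continuous_on {0..l} T"
  using deriv_T has_vector_derivative_continuous continuous_on_eq_continuous_within by blast

lemma cont_N: "continuous_on {0..l} (N i)"
  using deriv_N has_vector_derivative_continuous continuous_on_eq_continuous_within by blast

lemma curve_bounded:
  obtains b where "\<And>s. s \<in> {0..l} \<Longrightarrow> norm (\<Gamma> s) \<le> b"
  using compact_imp_bounded[OF compact_continuous_image[OF cont_curve compact_Icc]]
  unfolding bounded_iff by blast

lemma T_T: "s \<in> {0..l} \<Longrightarrow> T s \<bullet> T s = 1"
  using norm_T by (simp add: norm_eq_1)

lemma N_N: "s \<in> {0..l} \<Longrightarrow> N i s \<bullet> N j s = (if i = j then 1 else 0)"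
  using norm_N N_orth by (auto simp: norm_eq_1)

lemma offset_N: "s \<in> {0..l} \<Longrightarrow> offset s u \<bullet> N i s = u $ i"
  by (simp add: offset_def inner_sum_left N_N if_distrib cong: if_cong)

lemma offset_T: "s \<in> {0..l} \<Longrightarrow> offset s u \<bullet> T s = 0"
  by (simp add: offset_def inner_sum_left N_T)

lemma offset_dT: "offset s u \<bullet> dT s = u \<bullet> kappa s"
  by (simp add: offset_def kappa_def inner_sum_left inner_vec_def[of u] inner_commute[of "dT s"])

lemma offset_offset: "s \<in> {0..l} \<Longrightarrow> offset s u \<bullet> offset s v = u \<bullet> v"
  by (simp add: offset_def[of s v] inner_sum_right offset_N inner_vec_def[of u] mult.commute)

lemma norm_offset: "s \<in> {0..l} \<Longrightarrow> norm (offset s u) = norm u"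
  by (simp add: norm_eq_sqrt_inner offset_offset)

lemma offset_scale: "offset s (c *\<^sub>R u) = c *\<^sub>R offset s u"
  by (simp add: offset_def scaleR_sum_right)

lemma offset_zero: "offset s 0 = 0"
  by (simp add: offset_def)

lemma offset_eq_0_iff: "s \<in> {0..l} \<Longrightarrow> offset s u = 0 \<longleftrightarrow> u = 0"
  using norm_offset[of s u] by auto

lemma tangential_nu: "s \<in> {0..l} \<Longrightarrow> tangential (nu s u) s = 0"
  by (simp add: tangential_def nu_def offset_T)

lemma focal_nu: "focal (nu s u) s = jac s u"
  by (simp add: focal_def nu_def jac_def offset_dT)

lemma cont_kappa: "continuous_on {0..l} kappa"
  unfolding kappa_def by (intro continuous_on_vec_lambda continuous_intros cont_dT cont_N)

lemma deriv_tangential: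
  assumes "0 < t" "t < l"
  shows "(tangential x has_real_derivative - focal x t) (at t)"
proof -
  have t: "t \<in> {0..l}" using assms by auto
  have "((\<lambda>t. x - \<Gamma> t) has_vector_derivative 0 - T t) (at t within {0..l})"
    by (intro derivative_intros deriv_curve t)
  from bounded_bilinear.has_vector_derivative[OF bounded_bilinear_inner this deriv_T[OF t]]
  have "(tangential x has_vector_derivative - focal x t) (at t within {0..l})"
    by (simp add: tangential_def[abs_def] focal_def T_T[OF t] inner_diff_left algebra_simps)
  then show ?thesis
    using at_within_Icc_at[of 0 t l] assms by (simp add: has_real_derivative_iff_has_vector_derivative)
qed

lemma deriv_dist_sq:
  assumes "0 < t" "t < l"
  shows "((\<lambda>t. (x - \<Gamma> t) \<bullet> (x - \<Gamma> t)) has_real_derivative - 2 * tangential x t) (at t)"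
proof -
  have t: "t \<in> {0..l}" using assms by auto
  have *: "((\<lambda>t. x - \<Gamma> t) has_vector_derivative 0 - T t) (at t within {0..l})"
    by (intro derivative_intros deriv_curve t)
  from bounded_bilinear.has_vector_derivative[OF bounded_bilinear_inner * *]
  have "((\<lambda>t. (x - \<Gamma> t) \<bullet> (x - \<Gamma> t)) has_vector_derivative - 2 * tangential x t) (at t within {0..l})"
    by (simp add: tangential_def inner_commute)
  then show ?thesis
    using at_within_Icc_at[of 0 t l] assms by (simp add: has_real_derivative_iff_has_vector_derivative)
qed

lemma cont_tangential: "continuous_on {0..l} (tangential x)"
  unfolding tangential_def by (intro continuous_intros cont_curve cont_T)

lemma cont_dist_sq: "continuous_on {0..l} (\<lambda>t. (x - \<Gamma> t) \<bullet> (x - \<Gamma> t))"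
  by (intro continuous_intros cont_curve)

section \<open>Closest parameters and their stability\<close>

lemma ex_closest_param: "\<exists>m\<in>{0..l}. \<forall>t\<in>{0..l}. norm (x - \<Gamma> m) \<le> norm (x - \<Gamma> t)"
proof (rule continuous_attains_inf)
  show "continuous_on {0..l} (\<lambda>t. norm (x - \<Gamma> t))" by (intro continuous_intros cont_curve)
qed (use l_pos in auto)

lemma closest_params_iff:
  "s \<in> cp x \<longleftrightarrow> s \<in> {0..l} \<and> (\<forall>t\<in>{0..l}. norm (x - \<Gamma> s) \<le> norm (x - \<Gamma> t))"
proof -
  obtain m where m: "m \<in> {0..l}" "\<forall>t\<in>{0..l}. norm (x - \<Gamma> m) \<le> norm (x - \<Gamma> t)"
    using ex_closest_param by blast
  then have "(INF t\<in>{0..l}. norm (x - \<Gamma> t)) = norm (x - \<Gamma> m)"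
    by (intro cInf_eq_minimum) auto
  then show ?thesis
    using m by (force simp: closest_params_def)
qed

lemma closest_params_nonempty: "cp x \<noteq> {}"
  using ex_closest_param[of x] closest_params_iff by blast

lemma closest_params_subset: "cp x \<subseteq> {0..l}"
  by (auto simp: closest_params_def)

text \<open>Expanding the squares gives a condition linear in \<open>x - \<Gamma> s\<close>, the
  form suited to scaling that vector in \<open>closest_shrink\<close>.\<close>

lemma closest_params_inner:
  "s \<in> cp x \<longleftrightarrow> s \<in> {0..l} \<and>
     (\<forall>t\<in>{0..l}. 2 * ((x - \<Gamma> s) \<bullet> (\<Gamma> t - \<Gamma> s)) \<le> (\<Gamma> t - \<Gamma> s) \<bullet> (\<Gamma> t - \<Gamma> s))"
proof -
  have "norm (x - \<Gamma> s) \<le> norm (x - \<Gamma> t) \<longleftrightarrow>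
        2 * ((x - \<Gamma> s) \<bullet> (\<Gamma> t - \<Gamma> s)) \<le> (\<Gamma> t - \<Gamma> s) \<bullet> (\<Gamma> t - \<Gamma> s)" for t
    by (simp add: norm_le inner_diff inner_commute algebra_simps)
  then show ?thesis by (simp add: closest_params_iff)
qed

text \<open>For each fixed t the inequality against \<open>\<Gamma> t\<close> survives limits in the
  point and the parameter together. Compactness of closest sets, their stability and the
  measurability of the index all rest on this.\<close>

lemma closed_closest_graph: "closed {(x, s). s \<in> cp x}"
proof (subst closed_sequential_limits, safe)
  fix f :: "nat \<Rightarrow> _" and x s
  assume f: "\<forall>n. f n \<in> {(x, s). s \<in> cp x}" and lim: "f \<longlonglongrightarrow> (x, s)"
  have x: "(\<lambda>n. fst (f n)) \<longlonglongrightarrow> x" and s: "(\<lambda>n. snd (f n)) \<longlonglongrightarrow> s"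
    using tendsto_fst[OF lim] tendsto_snd[OF lim] by auto
  have fn: "snd (f n) \<in> {0..l}" "t \<in> {0..l} \<Longrightarrow> norm (fst (f n) - \<Gamma> (snd (f n))) \<le> norm (fst (f n) - \<Gamma> t)" for n t
    using f[rule_format, of n] by (auto simp: closest_params_iff split_beta)
  have s_in: "s \<in> {0..l}"
    by (rule closed_sequentially[OF closed_atLeastAtMost _ s]) (rule fn(1))
  have g: "(\<lambda>n. \<Gamma> (snd (f n))) \<longlonglongrightarrow> \<Gamma> s"
    by (rule continuous_on_tendsto_compose[OF cont_curve s s_in]) (use fn(1) in auto)
  show "s \<in> cp x"
    unfolding closest_params_iff
  proof (intro conjI ballI s_in)
    fix t assume t: "t \<in> {0..l}"
    show "norm (x - \<Gamma> s) \<le> norm (x - \<Gamma> t)"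
    proof (rule LIMSEQ_le)
      show "(\<lambda>n. norm (fst (f n) - \<Gamma> (snd (f n)))) \<longlonglongrightarrow> norm (x - \<Gamma> s)"
        by (intro tendsto_intros x g)
      show "(\<lambda>n. norm (fst (f n) - \<Gamma> t)) \<longlonglongrightarrow> norm (x - \<Gamma> t)"
        by (intro tendsto_intros x)
      show "\<exists>M. \<forall>n\<ge>M. norm (fst (f n) - \<Gamma> (snd (f n))) \<le> norm (fst (f n) - \<Gamma> t)"
        using fn t by auto
    qed
  qed
qed

lemma compact_closest_params: "compact (cp x)"
proof -
  have "closed ((\<lambda>s. (x, s)) -` {(x, s). s \<in> cp x})"
    by (intro closed_vimage closed_closest_graph continuous_intros)
  then have "closed (cp x)" by (simp add: vimage_def)
  then show ?thesis
    using closest_params_subset compact_Int_closed[of "{0..l}" "cp x"] by (simp add: Int_absorb1)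
qed

lemma index_in_closest: "index x \<in> cp x"
  unfolding projection_index_def
  by (intro closed_contains_Sup closest_params_nonempty compact_imp_closed compact_closest_params
      bdd_above_mono[OF _ closest_params_subset]) auto

lemma index_range: "index x \<in> {0..l}"
  using index_in_closest closest_params_subset by blast

lemma not_amb_iff: "x \<notin> amb \<longleftrightarrow> cp x = {index x}"
proof
  assume x: "x \<notin> amb"
  have "s = index x" if s: "s \<in> cp x" for s
  proof (rule inj_onD[OF inj])
    show "\<Gamma> s = \<Gamma> (index x)"
      using x s index_in_closest[of x] unfolding ambiguity_points_def by blast
    show "s \<in> {0..l}" using s closest_params_subset by blast
  qed (rule index_range)
  then show "cp x = {index x}" using index_in_closest[of x] by blast
next
  assume "cp x = {index x}"
  then show "x \<notin> amb" unfolding ambiguity_points_def by fastforce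
qed

lemma closest_singletonD:
  assumes "cp x = {s}" shows "index x = s" "x \<notin> amb"
proof -
  show 1: "index x = s" using index_in_closest[of x] assms by blast
  show "x \<notin> amb" unfolding not_amb_iff 1 by (rule assms)
qed

lemma slice_iff: "u \<in> slice s \<longleftrightarrow> cp (nu s u) = {s}"
  unfolding transverse_range_def normal_coord_map_nu
  using closest_singletonD[of "nu s u" s] not_amb_iff[of "nu s u"] by (metis (mono_tags, lifting) mem_Collect_eq)

text \<open>Closest parameters staying away from s0, for points tending to x0, would by compactness
  accumulate at a closest parameter of x0 other than s0.\<close>

lemma closest_stable:
  assumes "cp x0 = {s0}" "0 < e"
  obtains \<delta> where "0 < \<delta>" "\<And>x. dist x x0 < \<delta> \<Longrightarrow> cp x \<subseteq> ball s0 e"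
proof (rule ccontr)
  assume *: "\<not> thesis"
  have "\<exists>x s. dist x x0 < inverse (Suc n) \<and> s \<in> cp x \<and> e \<le> dist s0 s" for n :: nat
  proof -
    have "\<not> (\<forall>x. dist x x0 < inverse (Suc n) \<longrightarrow> cp x \<subseteq> ball s0 e)"
      using * that[of "inverse (Suc n)"] by auto
    then show ?thesis by (auto simp: subset_iff not_less)
  qed
  then obtain X S where XS: "\<And>n::nat. dist (X n) x0 < inverse (Suc n)" "\<And>n. S n \<in> cp (X n)" "\<And>n. e \<le> dist s0 (S n)"
    by metis
  have X: "X \<longlonglongrightarrow> x0"
    by (rule metric_tendsto_imp_tendsto[OF LIMSEQ_inverse_real_of_nat])
      (use XS(1) less_imp_le in \<open>auto simp: dist_real_def intro!: always_eventually\<close>)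
  have "S n \<in> {0..l}" for n using XS(2) closest_params_subset by blast
  then obtain s r where r: "strict_mono (r :: nat \<Rightarrow> nat)" and s: "(S \<circ> r) \<longlonglongrightarrow> s"
    using compact_Icc[of 0 l] unfolding compact_def by meson
  have "(\<lambda>n. (X (r n), S (r n))) \<longlonglongrightarrow> (x0, s)"
    using LIMSEQ_subseq_LIMSEQ[OF X r] s by (intro tendsto_Pair) (auto simp: comp_def)
  then have "(x0, s) \<in> {(x, s). s \<in> cp x}"
    by (rule closed_sequentially[OF closed_closest_graph, rotated]) (use XS(2) in auto)
  then have "s = s0" using assms by auto
  moreover have "e \<le> dist s0 s"
    by (rule LIMSEQ_le_const[OF tendsto_dist[OF tendsto_const s]]) (use XS(3) in auto)
  ultimately show False using assms by simp
qed

text \<open>The ball about \<open>\<Gamma> s + c *\<^sub>R w\<close> with \<open>\<Gamma> s\<close>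
  on its boundary lies in the corresponding ball about \<open>\<Gamma> s + w\<close> and touches its
  sphere only at \<open>\<Gamma> s\<close>, while the curve does not enter the open larger
  ball.\<close>

lemma closest_shrink:
  assumes "s \<in> cp (\<Gamma> s + w)" "0 \<le> c" "c < 1"
  shows "cp (\<Gamma> s + c *\<^sub>R w) = {s}"
proof -
  have s: "s \<in> {0..l}" using assms closest_params_subset by blast
  have *: "2 * (w \<bullet> (\<Gamma> t - \<Gamma> s)) \<le> (\<Gamma> t - \<Gamma> s) \<bullet> (\<Gamma> t - \<Gamma> s)" if "t \<in> {0..l}" for t
    using assms(1) that by (auto simp: closest_params_inner)
  have cw: "2 * c * (w \<bullet> (\<Gamma> t - \<Gamma> s)) \<le> c * ((\<Gamma> t - \<Gamma> s) \<bullet> (\<Gamma> t - \<Gamma> s))" if "t \<in> {0..l}" for t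
    using mult_left_mono[OF *[OF that] assms(2)] by (simp add: mult_ac)
  have c1: "c * ((\<Gamma> t - \<Gamma> s) \<bullet> (\<Gamma> t - \<Gamma> s)) \<le> (\<Gamma> t - \<Gamma> s) \<bullet> (\<Gamma> t - \<Gamma> s)" for t
    using mult_right_mono[of c 1 "(\<Gamma> t - \<Gamma> s) \<bullet> (\<Gamma> t - \<Gamma> s)"] assms by simp
  have mem: "s \<in> cp (\<Gamma> s + c *\<^sub>R w)"
    unfolding closest_params_inner
  proof (intro conjI ballI s)
    fix t assume "t \<in> {0..l}"
    from order_trans[OF cw[OF this] c1]
    show "2 * ((\<Gamma> s + c *\<^sub>R w - \<Gamma> s) \<bullet> (\<Gamma> t - \<Gamma> s)) \<le> (\<Gamma> t - \<Gamma> s) \<bullet> (\<Gamma> t - \<Gamma> s)"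
      by simp
  qed
  have "t = s" if t: "t \<in> cp (\<Gamma> s + c *\<^sub>R w)" for t
  proof -
    let ?v = "\<Gamma> t - \<Gamma> s"
    have tl: "t \<in> {0..l}" using t closest_params_subset by blast
    have "2 * ((\<Gamma> s + c *\<^sub>R w - \<Gamma> t) \<bullet> (\<Gamma> s - \<Gamma> t)) \<le> (\<Gamma> s - \<Gamma> t) \<bullet> (\<Gamma> s - \<Gamma> t)"
      using t s by (auto simp: closest_params_inner)
    \<comment> \<open>The minimality of t tested at s; combined with \<open>cw\<close> it bounds the
      square of v by c times itself.\<close>
    then have "?v \<bullet> ?v \<le> 2 * c * (w \<bullet> ?v)"
      by (simp add: inner_diff inner_add_left inner_commute algebra_simps)
    with cw[OF tl] have "?v \<bullet> ?v \<le> c * (?v \<bullet> ?v)" by linarith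
    then have "(1 - c) * (?v \<bullet> ?v) \<le> 0" by (simp add: algebra_simps)
    then have "?v \<bullet> ?v \<le> 0" using assms(3) by (simp add: mult_le_0_iff)
    then have "?v \<bullet> ?v = 0" using inner_ge_zero[of ?v] by linarith
    then have "?v = 0" by (simp only: inner_eq_zero_iff)
    then show ?thesis using inj_onD[OF inj, of t s] tl s by simp
  qed
  then show ?thesis using mem by blast
qed

section \<open>First- and second-order conditions at closest parameters\<close>

lemma tangential_zero_interior:
  assumes "s \<in> cp x" "0 < s" "s < l"
  shows "tangential x s = 0"
proof -
  have "- 2 * tangential x s = 0"
  proof (rule DERIV_local_min[OF deriv_dist_sq[OF assms(2,3)]])
    show "0 < min s (l - s)" using assms by simp
    show "\<forall>y. \<bar>s - y\<bar> < min s (l - s) \<longrightarrow> (x - \<Gamma> s) \<bullet> (x - \<Gamma> s) \<le> (x - \<Gamma> y) \<bullet> (x - \<Gamma> y)"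
    proof (intro allI impI)
      fix y assume "\<bar>s - y\<bar> < min s (l - s)"
      then have "y \<in> {0..l}" by auto
      then show "(x - \<Gamma> s) \<bullet> (x - \<Gamma> s) \<le> (x - \<Gamma> y) \<bullet> (x - \<Gamma> y)"
        using assms(1) by (auto simp: closest_params_iff norm_le)
    qed
  qed
  then show ?thesis by simp
qed

lemma cont_focal: "continuous_on (UNIV \<times> {0..l}) (\<lambda>(x, t). focal x t)"
  unfolding focal_def split_beta
  by (intro continuous_intros continuous_on_compose2[OF cont_curve] continuous_on_compose2[OF cont_dT]) auto

text \<open>Continuity jointly in point and parameter, one-sided at the end points. With U a
  half-line it says that the sign of \<open>focal\<close> persists uniformly.\<close>

lemma focal_near:
  assumes s: "s \<in> {0..l}" and U: "open U" "focal x s \<in> U"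
  obtains \<delta> where "0 < \<delta>" "\<And>y t. dist y x < \<delta> \<Longrightarrow> dist t s < \<delta> \<Longrightarrow> t \<in> {0..l} \<Longrightarrow> focal y t \<in> U"
proof -
  from cont_focal[unfolded continuous_on_open_invariant, rule_format, OF U(1)]
  obtain A where A: "open A" "A \<inter> UNIV \<times> {0..l} = (\<lambda>(x, t). focal x t) -` U \<inter> UNIV \<times> {0..l}"
    by auto
  have "(x, s) \<in> A" using A(2) s U(2) by (auto simp: set_eq_iff)
  then obtain B C where BC: "open B" "open C" "x \<in> B" "s \<in> C" "B \<times> C \<subseteq> A"
    using open_prod_elim[OF A(1)] by (metis mem_Sigma_iff)
  obtain b c where "b > 0" "\<And>y. dist y x < b \<Longrightarrow> y \<in> B" "c > 0" "\<And>y. dist y s < c \<Longrightarrow> y \<in> C"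
    using BC by (metis open_dist)
  then have "0 < min b c" "\<And>y t. dist y x < min b c \<Longrightarrow> dist t s < min b c \<Longrightarrow> t \<in> {0..l} \<Longrightarrow> focal y t \<in> U"
  proof -
    show "0 < min b c" using \<open>b > 0\<close> \<open>c > 0\<close> by simp
    fix y t assume "dist y x < min b c" "dist t s < min b c" and t: "t \<in> {0..l}"
    then have "(y, t) \<in> A" using BC(5) \<open>\<And>y. dist y x < b \<Longrightarrow> y \<in> B\<close> \<open>\<And>y. dist y s < c \<Longrightarrow> y \<in> C\<close> by auto
    then have "(y, t) \<in> A \<inter> UNIV \<times> {0..l}" using t by simp
    then show "focal y t \<in> U" unfolding A(2) by simp
  qed
  then show ?thesis using that by blast
qed

text \<open>The derivative of \<open>tangential y\<close> is \<open>- focal y\<close>, negative near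
  s for every y near x. Hence no nearby point has two zeros of \<open>tangential\<close> close to
  s.\<close>

lemma tangential_decreasing:
  assumes s: "s \<in> {0..l}" and "0 < focal x s"
  obtains \<delta> where "0 < \<delta>"
    "\<And>y a b. dist y x < \<delta> \<Longrightarrow> dist a s < \<delta> \<Longrightarrow> dist b s < \<delta> \<Longrightarrow> 0 \<le> a \<Longrightarrow> a < b \<Longrightarrow> b \<le> l \<Longrightarrow>
       tangential y b < tangential y a"
proof -
  obtain \<delta> where \<delta>: "0 < \<delta>"
    "\<And>y t. dist y x < \<delta> \<Longrightarrow> dist t s < \<delta> \<Longrightarrow> t \<in> {0..l} \<Longrightarrow> focal y t \<in> {0<..}"
    using focal_near[OF s open_greaterThan] assms(2) by (metis greaterThan_iff)
  show ?thesis
  proof (rule that[OF \<delta>(1)])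
    fix y a b assume y: "dist y x < \<delta>" and ab: "dist a s < \<delta>" "dist b s < \<delta>" "0 \<le> a" "a < b" "b \<le> l"
    show "tangential y b < tangential y a"
    proof (rule DERIV_neg_imp_decreasing_open[OF \<open>a < b\<close>])
      fix t assume t: "a < t" "t < b"
      then have "dist t s < \<delta>" using ab by (auto simp: dist_real_def)
      then have "0 < focal y t" using \<delta>(2)[OF y, of t] t ab by auto
      then show "\<exists>r. (tangential y has_real_derivative r) (at t) \<and> r < 0"
        using deriv_tangential[of t y] t ab by (intro exI[of _ "- focal y t"]) auto
    next
      show "continuous_on {a..b} (tangential y)"
        by (rule continuous_on_subset[OF cont_tangential]) (use ab in auto)
    qed
  qed
qed

text \<open>Second-order condition at a minimum, one-sided at the end points.\<close>

lemma focal_nonneg: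
  assumes s: "s \<in> cp x" and q: "tangential x s = 0"
  shows "0 \<le> focal x s"
proof (rule ccontr)
  assume "\<not> 0 \<le> focal x s"
  then have neg: "focal x s \<in> {..<0}" by simp
  have sl: "s \<in> {0..l}" using s closest_params_subset by blast
  obtain \<delta> where \<delta>: "0 < \<delta>"
    "\<And>y t. dist y x < \<delta> \<Longrightarrow> dist t s < \<delta> \<Longrightarrow> t \<in> {0..l} \<Longrightarrow> focal y t \<in> {..<0}"
    using focal_near[OF sl open_lessThan neg] by blast
  have inc: "tangential x a < tangential x b" if ab: "dist a s < \<delta>" "dist b s < \<delta>" "0 \<le> a" "a < b" "b \<le> l" for a b
  proof (rule DERIV_pos_imp_increasing_open[OF \<open>a < b\<close>])
    fix t assume t: "a < t" "t < b"
    then have "dist t s < \<delta>" using ab by (auto simp: dist_real_def)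
    then have "focal x t < 0" using \<delta>(2)[of x t] \<delta>(1) t ab by auto
    then show "\<exists>r. (tangential x has_real_derivative r) (at t) \<and> r > 0"
      using deriv_tangential[of t x] t ab by (intro exI[of _ "- focal x t"]) auto
  next
    show "continuous_on {a..b} (tangential x)"
      by (rule continuous_on_subset[OF cont_tangential]) (use ab in auto)
  qed
  \<comment> \<open>\<open>tangential\<close> vanishes at s and increases, so the squared distance,
    whose derivative is -2 times it, drops on leaving s in either direction. The step goes to the
    right unless s is the last parameter.\<close>
  let ?f = "\<lambda>t. (x - \<Gamma> t) \<bullet> (x - \<Gamma> t)"
  have "\<exists>t\<in>{0..l}. ?f t < ?f s"
  proof (cases "s < l")
    case True
    define b where "b = min l (s + \<delta> / 2)"
    have b: "s < b" "b \<le> l" "dist b s < \<delta>" using True \<delta>(1) by (auto simp: b_def dist_real_def)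
    have "?f b < ?f s"
    proof (rule DERIV_neg_imp_decreasing_open[OF b(1)])
      fix t assume t: "s < t" "t < b"
      have "tangential x s < tangential x t"
        using t b sl \<delta>(1) by (intro inc) (auto simp: dist_real_def)
      then show "\<exists>r. (?f has_real_derivative r) (at t) \<and> r < 0"
        using deriv_dist_sq[of t x] t b sl q by (intro exI[of _ "- 2 * tangential x t"]) auto
    next
      show "continuous_on {s..b} ?f"
        by (rule continuous_on_subset[OF cont_dist_sq]) (use b sl in auto)
    qed
    then show ?thesis using b sl by (intro bexI[of _ b]) auto
  next
    case False
    then have sl': "s = l" using sl by auto
    define b where "b = max 0 (s - \<delta> / 2)"
    have b: "b < s" "0 \<le> b" "dist b s < \<delta>" using sl' \<delta>(1) l_pos by (auto simp: b_def dist_real_def)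
    have "?f b < ?f s"
    proof (rule DERIV_pos_imp_increasing_open[OF b(1)])
      fix t assume t: "b < t" "t < s"
      have "tangential x t < tangential x s"
        using t b sl \<delta>(1) by (intro inc) (auto simp: dist_real_def)
      then show "\<exists>r. (?f has_real_derivative r) (at t) \<and> r > 0"
        using deriv_dist_sq[of t x] t b sl q by (intro exI[of _ "- 2 * tangential x t"]) auto
    next
      show "continuous_on {b..s} ?f"
        by (rule continuous_on_subset[OF cont_dist_sq]) (use b sl in auto)
    qed
    then show ?thesis using b sl by (intro bexI[of _ b]) auto
  qed
  then obtain t where "t \<in> {0..l}" "?f t < ?f s" by blast
  then show False using s unfolding closest_params_iff norm_le by (meson not_less)
qed

lemma jac_nonneg:
  assumes "s \<in> cp (nu s u)" shows "0 \<le> jac s u"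
  using focal_nonneg[OF assms] tangential_nu[of s u] closest_params_subset[of "nu s u"] assms focal_nu[of s u]
  by auto

lemma cont_offset: "continuous_on ({0..l} \<times> UNIV) (\<lambda>(s, u). offset s u)"
  unfolding offset_def split_beta
  by (intro continuous_intros continuous_on_compose2[OF cont_N]) auto

lemma cont_nu: "continuous_on ({0..l} \<times> UNIV) (\<lambda>(s, u). nu s u)"
proof -
  have "continuous_on ({0..l} \<times> UNIV) (\<lambda>z. \<Gamma> (fst z) + (\<lambda>(s, u). offset s u) z)"
    by (intro continuous_intros continuous_on_compose2[OF cont_curve] cont_offset) auto
  then show ?thesis by (simp add: nu_def split_beta)
qed

text \<open>All closest parameters of \<open>nu s u\<close> lie near s0, hence inside the open
  interval, hence are zeros of \<open>tangential\<close>. Strict monotonicity admits only one zero,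
  and s is one because \<open>nu s u\<close> lies in the normal space at s.\<close>

lemma slice_open:
  assumes s0: "0 < s0" "s0 < l" and u0: "u0 \<in> slice s0" and J: "0 < jac s0 u0"
  shows "\<forall>\<^sub>F z in nhds (s0, u0). snd z \<in> slice (fst z)"
proof -
  define x0 where "x0 = nu s0 u0"
  have s0': "s0 \<in> {0..l}" using s0 by auto
  have cp0: "cp x0 = {s0}" using u0 by (simp add: slice_iff x0_def)
  have "0 < focal x0 s0" using J by (simp add: x0_def focal_nu)
  then obtain \<delta> where \<delta>: "0 < \<delta>"
    "\<And>y a b. dist y x0 < \<delta> \<Longrightarrow> dist a s0 < \<delta> \<Longrightarrow> dist b s0 < \<delta> \<Longrightarrow> 0 \<le> a \<Longrightarrow> a < b \<Longrightarrow> b \<le> l \<Longrightarrow>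
       tangential y b < tangential y a"
    using tangential_decreasing[OF s0'] by blast
  \<comment> \<open>Keeps closest parameters away from the ends, where the first-order condition may
    fail, and within the range of monotonicity.\<close>
  define e where "e = min \<delta> (min s0 (l - s0))"
  have e: "0 < e" "e \<le> \<delta>" "e \<le> s0" "e \<le> l - s0" using s0 \<delta>(1) by (auto simp: e_def)
  obtain \<eta> where \<eta>: "0 < \<eta>" "\<And>x. dist x x0 < \<eta> \<Longrightarrow> cp x \<subseteq> ball s0 e"
    using closest_stable[OF cp0 e(1)] by blast
  have "isCont (\<lambda>(s, u). nu s u) (s0, u0)"
    by (rule continuous_on_interior[OF cont_nu])
       (use s0 in \<open>auto simp: interior_Times\<close>)
  then have lim: "((\<lambda>(s, u). nu s u) \<longlongrightarrow> x0) (nhds (s0, u0))"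
    using tendsto_at_iff_tendsto_nhds[of "\<lambda>(s, u). nu s u" "(s0, u0)"] by (simp add: x0_def isCont_def)
  have near: "\<forall>\<^sub>F z in nhds (s0, u0). dist (nu (fst z) (snd z)) x0 < min \<delta> \<eta>"
    using tendstoD[OF lim, of "min \<delta> \<eta>"] \<delta>(1) \<eta>(1) by (simp add: split_beta)
  have "((\<lambda>z. fst z) \<longlongrightarrow> s0) (nhds (s0, u0))"
    using tendsto_fst[OF filterlim_ident, of "(s0, u0)"] by simp
  from tendstoD[OF this e(1)] have "\<forall>\<^sub>F z in nhds (s0, u0). dist (fst z) s0 < e" .
  with near show ?thesis
  proof eventually_elim
    case (elim z)
    define s x where "s = fst z" and "x = nu (fst z) (snd z)"
    have s: "dist s s0 < e" "0 < s" "s < l" using elim e by (auto simp: s_def dist_real_def)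
    have x: "dist x x0 < \<delta>" "dist x x0 < \<eta>" using elim by (auto simp: x_def)
    have qs: "tangential x s = 0" using s by (simp add: x_def s_def tangential_nu)
    have "t = s" if t: "t \<in> cp x" for t
    proof -
      have td: "dist t s0 < e" using \<eta>(2)[OF x(2)] t by (auto simp: dist_commute)
      then have tl: "0 < t" "t < l" using e by (auto simp: dist_real_def)
      have "tangential x t = 0" using tangential_zero_interior[OF t tl] .
      then show ?thesis
        using \<delta>(2)[OF x(1), of t s] \<delta>(2)[OF x(1), of s t] s tl td e qs by fastforce
    qed
    then have "cp x = {s}" using closest_params_nonempty[of x] by blast
    then show ?case by (simp add: slice_iff x_def s_def)
  qed
qed

text \<open>Otherwise \<open>K\<close> contains an unambiguous point slightly beyond the end. There
  \<open>tangential\<close> is negative at 0, respectively positive at l, and being decreasing it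
  keeps this sign on the nearby part of the curve, so it cannot vanish at the index.\<close>

lemma nu_not_interior_at_endpoint:
  assumes s0: "s0 = 0 \<or> s0 = l" and u0: "u0 \<in> slice s0" and J: "0 < jac s0 u0"
    and K: "\<And>x. x \<in> K - amb \<Longrightarrow> tangential x (index x) = 0"
    and amb: "negligible amb"
  shows "nu s0 u0 \<notin> interior K"
proof
  assume int: "nu s0 u0 \<in> interior K"
  define x0 where "x0 = nu s0 u0"
  have s0': "s0 \<in> {0..l}" using s0 l_pos by auto
  have cp0: "cp x0 = {s0}" using u0 by (simp add: slice_iff x0_def)
  have "0 < focal x0 s0" using J by (simp add: x0_def focal_nu)
  then obtain \<delta> where \<delta>: "0 < \<delta>"
    "\<And>y a b. dist y x0 < \<delta> \<Longrightarrow> dist a s0 < \<delta> \<Longrightarrow> dist b s0 < \<delta> \<Longrightarrow> 0 \<le> a \<Longrightarrow> a < b \<Longrightarrow> b \<le> l \<Longrightarrow>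
       tangential y b < tangential y a"
    using tangential_decreasing[OF s0'] by blast
  obtain \<eta> where \<eta>: "0 < \<eta>" "\<And>x. dist x x0 < \<eta> \<Longrightarrow> cp x \<subseteq> ball s0 \<delta>"
    using closest_stable[OF cp0 \<delta>(1)] by blast
  obtain r where r: "0 < r" "ball x0 r \<subseteq> K"
    using int unfolding x0_def mem_interior by blast
  \<comment> \<open>The test ball below has radius h and centre at distance h from x0, so it stays
    within 2h of x0.\<close>
  define h where "h = min r (min \<delta> \<eta>) / 2"
  have h: "0 < h" "2 * h \<le> r" "2 * h \<le> \<delta>" "2 * h \<le> \<eta>" using r \<delta> \<eta> by (auto simp: h_def)
  \<comment> \<open>Direction pointing out of the curve. A whole ball is tested because only almost
    every point is unambiguous; its radius h is small enough for \<open>tangential x s0\<close> to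
    have the sign of \<sigma> on all of it.\<close>
  define \<sigma> :: real where "\<sigma> = (if s0 = 0 then - 1 else 1)"
  define c where "c = x0 + (\<sigma> * h) *\<^sub>R T s0"
  have "\<not> negligible (ball c h)"
    using open_not_negligible[of "ball c h"] h(1) by auto
  then obtain x where x: "x \<in> ball c h" "x \<notin> amb"
    using negligible_subset[OF amb] by blast
  have "dist c x0 = h"
    using norm_T[OF s0'] h(1) by (simp add: c_def dist_norm \<sigma>_def)
  then have xd: "dist x x0 < 2 * h"
    using x(1) dist_triangle[of x x0 c] by (simp add: dist_commute)
  have xK: "x \<in> K - amb" using xd h(2) r(2) x(2) by (auto simp: dist_commute subset_iff)
  define t where "t = index x"
  have t: "tangential x t = 0" "t \<in> cp x" "t \<in> {0..l}"
    using K[OF xK] index_in_closest index_range by (auto simp: t_def)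
  have td: "dist t s0 < \<delta>" using \<eta>(2)[of x] xd h(4) t(2) by (auto simp: dist_commute)
  have "tangential x s0 = \<sigma> * h + (x - c) \<bullet> T s0"
  proof -
    have "tangential x s0 = tangential x0 s0 + (c - x0) \<bullet> T s0 + (x - c) \<bullet> T s0"
      by (simp add: tangential_def inner_diff_left algebra_simps)
    then show ?thesis using tangential_nu[OF s0', of u0] T_T[OF s0'] by (simp add: x0_def[symmetric] c_def)
  qed
  moreover have "\<bar>(x - c) \<bullet> T s0\<bar> < h"
  proof -
    have "\<bar>(x - c) \<bullet> T s0\<bar> \<le> norm (x - c) * norm (T s0)" by (rule Cauchy_Schwarz_ineq2)
    then show ?thesis using norm_T[OF s0'] x(1) by (simp add: dist_norm norm_minus_commute)
  qed
  ultimately have sg: "s0 = 0 \<Longrightarrow> tangential x s0 < 0" "s0 \<noteq> 0 \<Longrightarrow> tangential x s0 > 0"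
    by (auto simp: \<sigma>_def)
  have xd': "dist x x0 < \<delta>" using xd h(3) by simp
  show False
  proof (cases "s0 = 0")
    case True
    then show False
      using sg(1) t td \<delta>(2)[OF xd', of s0 t] \<delta>(1) by (cases "t = s0") auto
  next
    case False
    then have "s0 = l" using s0 by simp
    then show False
      using sg(2)[OF False] t td \<delta>(2)[OF xd', of t s0] \<delta>(1) by (cases "t = s0") auto
  qed
qed

end

section \<open>Ambiguity points and measurability of the projection index\<close>

text \<open>All translates of S along e have the measure of S. Averaging them over t in {0..1} and
  exchanging the integrals leaves, for each x, an integral over a countable set of t.\<close>

lemma null_set_if_countable_on_lines:
  fixes S :: "'a::euclidean_space set"
  assumes S[measurable]: "S \<in> sets borel" and lines: "\<And>x. countable {t::real. x + t *\<^sub>R e \<in> S}"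
  shows "S \<in> null_sets lborel"
proof -
  let ?f = "\<lambda>(t::real, x::'a). indicator {0..1} t * indicator S (x + t *\<^sub>R e) :: ennreal"
  have [measurable]: "?f \<in> borel_measurable (lborel \<Otimes>\<^sub>M lborel)" by measurable
  have 0: "(\<integral>\<^sup>+x. indicator S (x + c) \<partial>lborel) = emeasure lborel S" for c :: 'a
  proof -
    have "(\<integral>\<^sup>+x. indicator S (x + c) \<partial>lborel) = (\<integral>\<^sup>+x. indicator S x \<partial>distr lborel borel ((+) c))"
      by (subst nn_integral_distr) (auto simp: add.commute)
    then show ?thesis by (simp add: lborel_distr_plus)
  qed
  have "emeasure lborel S = (\<integral>\<^sup>+t. (\<integral>\<^sup>+x. ?f (t, x) \<partial>lborel) \<partial>lborel)"
    by (simp add: nn_integral_cmult 0 nn_integral_multc)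
  also have "\<dots> = (\<integral>\<^sup>+x. (\<integral>\<^sup>+t. ?f (t, x) \<partial>lborel) \<partial>lborel)"
    by (rule lborel_pair.Fubini'[symmetric]) simp
  also have "\<dots> = (\<integral>\<^sup>+x. 0 \<partial>(lborel :: 'a measure))"
  proof (rule nn_integral_cong)
    fix x :: 'a
    have "AE t in lborel. t \<notin> {t. x + t *\<^sub>R e \<in> S}"
      by (rule AE_not_in[OF countable_imp_null_set_lborel[OF lines]])
    then have "(\<integral>\<^sup>+t. ?f (t, x) \<partial>lborel) = (\<integral>\<^sup>+t. 0 \<partial>(lborel :: real measure))"
      by (intro nn_integral_cong_AE) (auto simp: indicator_def)
    then show "(\<integral>\<^sup>+t. ?f (t, x) \<partial>lborel) = 0" by simp
  qed
  finally show ?thesis by (simp add: null_sets_def)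
qed

context framed_curve
begin

text \<open>The sum of the two minimality inequalities, each tested at the other parameter.
  Equivalently, closest points are subgradients of the convex function sup over t of
  \<open>x \<bullet> \<Gamma> t\<close> minus half the square of \<open>\<Gamma> t\<close>, and
  subgradients are monotone.\<close>

lemma closest_monotone:
  assumes "s \<in> cp x" "t \<in> cp y"
  shows "0 \<le> (y - x) \<bullet> (\<Gamma> t - \<Gamma> s)"
proof -
  have st: "s \<in> {0..l}" "t \<in> {0..l}" using assms closest_params_subset by blast+
  then have "(x - \<Gamma> s) \<bullet> (x - \<Gamma> s) \<le> (x - \<Gamma> t) \<bullet> (x - \<Gamma> t)"
    "(y - \<Gamma> t) \<bullet> (y - \<Gamma> t) \<le> (y - \<Gamma> s) \<bullet> (y - \<Gamma> s)"
    using assms by (simp_all add: closest_params_iff norm_le)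
  then show ?thesis by (simp add: inner_diff inner_commute)
qed

text \<open>Distinct closest points differ in some coordinate k by at least some
  \<open>inverse (Suc n)\<close>. Fixing the gap turns an open condition into a closed one.\<close>

definition amb_part :: "'d \<Rightarrow> nat \<Rightarrow> (real ^ 'd) set" where
  "amb_part k n = {x. \<exists>s t. s \<in> cp x \<and> t \<in> cp x \<and> \<Gamma> s $ k + inverse (Suc n) \<le> \<Gamma> t $ k}"

text \<open>The pair of parameters ranges over a compact square, and projecting a closed set along a
  compact factor leaves it closed.\<close>

lemma closed_amb_part: "closed (amb_part k n)"
proof -
  let ?D = "({0..l} \<times> {0..l}) \<times> (UNIV :: (real ^ 'd) set)"
  have c: "continuous_on ?D (\<lambda>z. \<Gamma> (snd (fst z)) $ k - \<Gamma> (fst (fst z)) $ k)"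
    by (intro continuous_intros continuous_on_compose2[OF cont_curve]) auto
  have 1: "closed (?D \<inter> (\<lambda>z. \<Gamma> (snd (fst z)) $ k - \<Gamma> (fst (fst z)) $ k) -` {inverse (Suc n)..})"
    by (intro continuous_closed_preimage c closed_Times) auto
  have 2: "closed ((\<lambda>z. (snd z, fst (fst z))) -` {(x, s). s \<in> cp x})"
    "closed ((\<lambda>z. (snd z, snd (fst z))) -` {(x, s). s \<in> cp x})"
    by (intro closed_vimage closed_closest_graph continuous_intros)+
  let ?T = "(?D \<inter> (\<lambda>z. \<Gamma> (snd (fst z)) $ k - \<Gamma> (fst (fst z)) $ k) -` {inverse (Suc n)..}) \<inter>
    ((\<lambda>z. (snd z, fst (fst z))) -` {(x, s). s \<in> cp x}) \<inter> ((\<lambda>z. (snd z, snd (fst z))) -` {(x, s). s \<in> cp x})"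
  have "closed {y. \<exists>x. x \<in> {0..l} \<times> {0..l} \<and> (x, y) \<in> ?T}"
    by (intro closed_compact_projection compact_Times compact_Icc closed_Int 1 2)
  also have "{y. \<exists>x. x \<in> {0..l} \<times> {0..l} \<and> (x, y) \<in> ?T} = amb_part k n"
  proof (intro equalityI subsetI)
    fix y assume "y \<in> amb_part k n"
    then obtain s t where st: "s \<in> cp y" "t \<in> cp y" "\<Gamma> s $ k + inverse (Suc n) \<le> \<Gamma> t $ k"
      by (auto simp: amb_part_def)
    moreover have "s \<in> {0..l}" "t \<in> {0..l}" using st closest_params_subset by blast+
    ultimately show "y \<in> {y. \<exists>x. x \<in> {0..l} \<times> {0..l} \<and> (x, y) \<in> ?T}"
      by (intro CollectI exI[of _ "(s, t)"]) simp
  next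
    fix y assume "y \<in> {y. \<exists>x. x \<in> {0..l} \<times> {0..l} \<and> (x, y) \<in> ?T}"
    then obtain s t where "((s, t), y) \<in> ?T" by auto
    then show "y \<in> amb_part k n" unfolding amb_part_def by (intro CollectI exI[of _ s] exI[of _ t]) simp
  qed
  finally show ?thesis .
qed

lemma amb_eq: "amb = (\<Union>k n. amb_part k n)"
proof (intro equalityI subsetI)
  fix x assume "x \<in> amb"
  then obtain s t where st: "s \<in> cp x" "t \<in> cp x" "\<Gamma> s \<noteq> \<Gamma> t"
    unfolding ambiguity_points_def by blast
  then obtain k where "\<Gamma> s $ k \<noteq> \<Gamma> t $ k" by (auto simp: vec_eq_iff)
  then obtain s' t' where st': "s' \<in> cp x" "t' \<in> cp x" "\<Gamma> s' $ k < \<Gamma> t' $ k"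
    using st(1,2) by (metis linorder_neqE_linordered_idom)
  then obtain n where "inverse (real (Suc n)) < \<Gamma> t' $ k - \<Gamma> s' $ k"
    using reals_Archimedean[of "\<Gamma> t' $ k - \<Gamma> s' $ k"] by auto
  then have "x \<in> amb_part k n" using st' unfolding amb_part_def by (intro CollectI exI[of _ s'] exI[of _ t']) simp
  then show "x \<in> (\<Union>k n. amb_part k n)" by blast
next
  fix x assume "x \<in> (\<Union>k n. amb_part k n)"
  then obtain k n s t where st: "s \<in> cp x" "t \<in> cp x" "\<Gamma> s $ k + inverse (Suc n) \<le> \<Gamma> t $ k"
    by (auto simp: amb_part_def)
  moreover have "0 < inverse (real (Suc n))" by simp
  ultimately have "\<Gamma> s $ k < \<Gamma> t $ k" by linarith
  then have "\<Gamma> s \<noteq> \<Gamma> t" by auto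
  then show "x \<in> amb" using st(1,2) unfolding ambiguity_points_def by blast
qed

text \<open>Moving in the direction of a coordinate axis, that coordinate of the closest points is
  monotone, so it jumps at most countably often.\<close>

lemma amb_part_null: "amb_part k n \<in> null_sets lborel"
proof (rule null_set_if_countable_on_lines[where e = "axis k 1"])
  show "amb_part k n \<in> sets borel" using closed_amb_part by (rule borel_closed)
  fix x
  let ?y = "\<lambda>t. x + t *\<^sub>R axis k (1::real)"
  let ?C = "{t. ?y t \<in> amb_part k n}"
  \<comment> \<open>A rational inside the jump of the k-th coordinate at t. Jumps at different t are
    ordered like the t, so these rationals are distinct.\<close>
  have "\<exists>q. q \<in> \<rat> \<and> (\<exists>a b. a \<in> cp (?y t) \<and> b \<in> cp (?y t) \<and> \<Gamma> a $ k < q \<and> q < \<Gamma> b $ k)"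
    if "t \<in> ?C" for t
  proof -
    obtain a b where ab: "a \<in> cp (?y t)" "b \<in> cp (?y t)" "\<Gamma> a $ k + inverse (Suc n) \<le> \<Gamma> b $ k"
      using \<open>t \<in> ?C\<close> by (auto simp: amb_part_def)
    moreover have "0 < inverse (real (Suc n))" by simp
    ultimately have "\<Gamma> a $ k < \<Gamma> b $ k" by linarith
    then show ?thesis using ab Rats_dense_in_real by blast
  qed
  then obtain q a b where q: "\<And>t. t \<in> ?C \<Longrightarrow> q t \<in> \<rat> \<and> a t \<in> cp (?y t) \<and> b t \<in> cp (?y t) \<and>
      \<Gamma> (a t) $ k < q t \<and> q t < \<Gamma> (b t) $ k"
    by metis
  have less: "q t < q t'" if "t \<in> ?C" "t' \<in> ?C" "t < t'" for t t'
  proof -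
    have "0 \<le> (?y t' - ?y t) \<bullet> (\<Gamma> (a t') - \<Gamma> (b t))"
      using q that by (intro closest_monotone) auto
    also have "?y t' - ?y t = (t' - t) *\<^sub>R axis k 1" by (simp add: algebra_simps)
    finally have "0 \<le> (t' - t) * (\<Gamma> (a t') $ k - \<Gamma> (b t) $ k)"
      by (simp add: inner_axis')
    then have "\<Gamma> (b t) $ k \<le> \<Gamma> (a t') $ k" using that(3) by (simp add: zero_le_mult_iff)
    then show ?thesis using q[OF that(1)] q[OF that(2)] by linarith
  qed
  then have "inj_on q ?C" unfolding inj_on_def by (metis (no_types, lifting) linorder_neqE_linordered_idom order_less_irrefl)
  moreover have "countable (q ` ?C)"
    by (rule countable_subset[OF _ countable_rat]) (use q in blast)
  ultimately show "countable ?C" using countable_image_inj_on by blast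
qed

lemma amb_null: "amb \<in> null_sets lborel"
  unfolding amb_eq by (intro null_sets_UN' amb_part_null) (auto intro: countable_finite)

lemma amb_borel [measurable]: "amb \<in> sets borel"
  using amb_null by auto

lemma amb_negligible: "negligible amb"
  using amb_null by (simp add: negligible_iff_null_sets null_sets_completionI)

text \<open>The index is upper semicontinuous: it is at least c exactly if some closest parameter
  is, and such points form the projection of a closed set along a compact interval.\<close>

lemma index_measurable [measurable]: "index \<in> borel_measurable borel"
  unfolding borel_measurable_iff_ge
proof
  fix c
  have "closed {x. \<exists>s. s \<in> {0..l} \<inter> {c..} \<and> (s, x) \<in> (\<lambda>(s, x). (x, s)) -` {(x, s). s \<in> cp x}}"
    unfolding split_beta
    by (intro closed_compact_projection closed_vimage closed_closest_graph[unfolded split_beta] compact_Int_closed)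
       (auto intro!: continuous_intros)
  moreover have "{x. \<exists>s. s \<in> {0..l} \<inter> {c..} \<and> (s, x) \<in> (\<lambda>(s, x). (x, s)) -` {(x, s). s \<in> cp x}} = {x. c \<le> index x}"
  proof (intro equalityI subsetI)
    fix x assume "x \<in> {x. \<exists>s. s \<in> {0..l} \<inter> {c..} \<and> (s, x) \<in> (\<lambda>(s, x). (x, s)) -` {(x, s). s \<in> cp x}}"
    then obtain s where "s \<in> cp x" "c \<le> s" by auto
    moreover have "s \<le> index x" unfolding projection_index_def
      using \<open>s \<in> cp x\<close> by (intro cSup_upper bdd_above_mono[OF _ closest_params_subset]) auto
    ultimately show "x \<in> {x. c \<le> index x}" by simp
  next
    fix x assume "x \<in> {x. c \<le> index x}"
    then show "x \<in> {x. \<exists>s. s \<in> {0..l} \<inter> {c..} \<and> (s, x) \<in> (\<lambda>(s, x). (x, s)) -` {(x, s). s \<in> cp x}}"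
      using index_in_closest[of x] index_range[of x] by auto
  qed
  ultimately show "{w \<in> space borel. c \<le> index w} \<in> sets borel" by simp
qed

end

section \<open>The Jacobian of the normal coordinate map\<close>

text \<open>The change-of-variables theorem of the library needs an index type of class \<open>wellorder\<close>;
  this one has one element more than \<open>'a\<close>.\<close>

typedef 'a suc_index = "{..CARD('a)}"
  by auto

instantiation suc_index :: (type) linorder
begin
definition "x \<le> y \<longleftrightarrow> Rep_suc_index x \<le> Rep_suc_index y"
definition "x < y \<longleftrightarrow> Rep_suc_index x < Rep_suc_index y"
instance
proof
  fix x y z :: "'a suc_index"
  show "x < y \<longleftrightarrow> x \<le> y \<and> \<not> y \<le> x" unfolding less_eq_suc_index_def less_suc_index_def by linarith
  show "x \<le> x" unfolding less_eq_suc_index_def by simp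
  show "x \<le> y \<Longrightarrow> y \<le> z \<Longrightarrow> x \<le> z" unfolding less_eq_suc_index_def by linarith
  show "x \<le> y \<Longrightarrow> y \<le> x \<Longrightarrow> x = y"
    unfolding less_eq_suc_index_def Rep_suc_index_inject[symmetric] by linarith
  show "x \<le> y \<or> y \<le> x" unfolding less_eq_suc_index_def by linarith
qed
end

instance suc_index :: (type) wellorder
proof
  fix P :: "'a suc_index \<Rightarrow> bool" and a
  assume step: "\<And>x. (\<And>y. y < x \<Longrightarrow> P y) \<Longrightarrow> P x"
  show "P a"
  proof (induction a rule: measure_induct_rule[where f = Rep_suc_index])
    case (less x)
    show ?case by (rule step, rule less) (unfold less_suc_index_def)
  qed
qed

lemma card_suc_index: "CARD('a suc_index) = Suc CARD('a)"
  using type_definition.card[OF type_definition_suc_index] by simp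

instance suc_index :: (type) finite
proof
  show "finite (UNIV :: 'a suc_index set)"
    using card_suc_index[where 'a = 'a] card.infinite by fastforce
qed

text \<open>Used to pass between ambient space, the product space of normal coordinates and the
  vectors over \<open>suc_index\<close>, which have equal dimension but different bases.\<close>

lemma ex_basis_isometry:
  assumes "DIM('a) = DIM('b)"
  obtains T :: "'a::euclidean_space \<Rightarrow> 'b::euclidean_space" and T'
  where "linear T" "linear T'" "bij_betw T Basis Basis" "bij_betw T' Basis Basis"
    "\<And>x. T' (T x) = x" "\<And>y. T (T' y) = y"
proof -
  obtain f where f: "bij_betw f (Basis :: 'a set) (Basis :: 'b set)"
    using finite_same_card_bij[OF finite_Basis finite_Basis assms] by blast
  define g where "g = inv_into Basis f"
  have g: "bij_betw g Basis Basis" unfolding g_def by (rule bij_betw_inv_into[OF f])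
  define T where "T x = (\<Sum>b\<in>Basis. (x \<bullet> b) *\<^sub>R f b)" for x
  define T' where "T' y = (\<Sum>b\<in>Basis. (y \<bullet> b) *\<^sub>R g b)" for y
  have lin: "linear T" "linear T'"
    unfolding T_def T'_def by (auto intro!: linearI simp: inner_add_left scaleR_add_left sum.distrib scaleR_sum_right)
  have Tb: "T b = f b" if "b \<in> Basis" for b
    using that by (simp add: T_def inner_Basis if_distrib[of "\<lambda>c. c *\<^sub>R _"] cong: if_cong)
  have T'b: "T' b = g b" if "b \<in> Basis" for b
    using that by (simp add: T'_def inner_Basis if_distrib[of "\<lambda>c. c *\<^sub>R _"] cong: if_cong)
  have gf: "g (f b) = b" if "b \<in> Basis" for b
    using that f unfolding g_def by (rule bij_betw_inv_into_left[rotated])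
  have fg: "f (g b) = b" if "b \<in> Basis" for b
    using that f unfolding g_def by (rule bij_betw_inv_into_right[rotated])
  have 1: "bij_betw T Basis Basis" using f Tb bij_betw_cong by blast
  have 2: "bij_betw T' Basis Basis" using g T'b bij_betw_cong by blast
  have "(T' \<circ> T) = id"
    by (rule linear_eq_stdbasis[OF linear_compose[OF lin] linear_id])
       (use Tb T'b gf bij_betwE[OF f] in auto)
  moreover have "(T \<circ> T') = id"
    by (rule linear_eq_stdbasis[OF linear_compose[OF lin(2,1)] linear_id])
       (use Tb T'b fg bij_betwE[OF g] in auto)
  ultimately show ?thesis using that[OF lin 1 2] by (metis comp_apply id_apply)
qed

lemma basis_map_inner:
  fixes T :: "'a::euclidean_space \<Rightarrow> 'b::euclidean_space"
  assumes T: "linear T" "bij_betw T Basis Basis"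
  shows "T x \<bullet> T y = x \<bullet> y"
proof -
  have 1: "T x \<bullet> T c = x \<bullet> c" if c: "c \<in> Basis" for x c
  proof -
    have "T x = T (\<Sum>b\<in>Basis. (x \<bullet> b) *\<^sub>R b)" by (simp add: euclidean_representation)
    also have "\<dots> = (\<Sum>b\<in>Basis. (x \<bullet> b) *\<^sub>R T b)"
      by (simp add: linear_sum[OF T(1)] linear_scale[OF T(1)])
    finally have "T x \<bullet> T c = (\<Sum>b\<in>Basis. (x \<bullet> b) * (T b \<bullet> T c))" by (simp add: inner_sum_left)
    also have "\<dots> = (\<Sum>b\<in>Basis. (x \<bullet> b) * (if b = c then 1 else 0))"
    proof (rule sum.cong[OF refl])
      fix b :: 'a assume b: "b \<in> Basis"
      have "T b \<in> Basis" "T c \<in> Basis" "T b = T c \<longleftrightarrow> b = c"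
        using T(2) b c unfolding bij_betw_def inj_on_def by blast+
      then show "(x \<bullet> b) * (T b \<bullet> T c) = (x \<bullet> b) * (if b = c then 1 else 0)"
        by (simp add: inner_Basis)
    qed
    also have "\<dots> = x \<bullet> c" using c by (simp add: if_distrib cong: if_cong)
    finally show ?thesis .
  qed
  have "T x \<bullet> T y = (\<Sum>e\<in>Basis. (T x \<bullet> e) * (T y \<bullet> e))" by (rule euclidean_inner)
  also have "\<dots> = (\<Sum>b\<in>Basis. (T x \<bullet> T b) * (T y \<bullet> T b))"
    by (rule sum.reindex_bij_betw[OF T(2), symmetric])
  also have "\<dots> = x \<bullet> y" by (simp add: 1 euclidean_inner[of x y])
  finally show ?thesis .
qed

text \<open>Such a map only relabels the sides of a box, so box volumes are preserved, and these
  determine Lebesgue measure.\<close>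

lemma lborel_distr_basis_map:
  fixes T :: "'a::euclidean_space \<Rightarrow> 'b::euclidean_space"
  assumes T: "linear T" "bij_betw T Basis Basis"
  shows "distr lborel borel T = lborel"
proof (rule lborel_eqI[symmetric])
  have [measurable]: "T \<in> borel_measurable borel"
    by (intro borel_measurable_continuous_onI linear_continuous_on linear_conv_bounded_linear[THEN iffD1] T)
  have img: "Basis = T ` Basis" using T(2) by (simp add: bij_betw_def)
  fix c d :: 'b assume le: "\<And>b. b \<in> Basis \<Longrightarrow> c \<bullet> b \<le> d \<bullet> b"
  let ?p = "\<lambda>c. \<Sum>b\<in>Basis. (c \<bullet> T b) *\<^sub>R b"
  have p: "?p c \<bullet> b = c \<bullet> T b" if "b \<in> Basis" for b c using that by simp
  have "T -` box c d = {x. \<forall>b\<in>Basis. c \<bullet> T b < T x \<bullet> T b \<and> T x \<bullet> T b < d \<bullet> T b}"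
    unfolding box_def by (subst img) auto
  also have "\<dots> = box (?p c) (?p d)"
    by (simp add: box_def basis_map_inner[OF T])
  finally have eq: "T -` box c d = box (?p c) (?p d)" .
  have "emeasure (distr lborel borel T) (box c d) = emeasure lborel (box (?p c) (?p d))"
    by (simp add: emeasure_distr eq)
  also have "\<dots> = (\<Prod>b\<in>Basis. (?p d - ?p c) \<bullet> b)"
  proof (rule emeasure_lborel_box)
    fix b :: 'a assume b: "b \<in> Basis"
    then have "T b \<in> Basis" using img by blast
    then show "?p c \<bullet> b \<le> ?p d \<bullet> b" using le b by simp
  qed
  also have "(\<Prod>b\<in>Basis. (?p d - ?p c) \<bullet> b) = (\<Prod>b\<in>Basis. (d - c) \<bullet> T b)"
    by (intro prod.cong refl) (simp add: inner_diff_left)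
  also have "\<dots> = (\<Prod>b\<in>Basis. (d - c) \<bullet> b)"
    by (rule prod.reindex_bij_betw[OF T(2)])
  finally show "emeasure (distr lborel borel T) (box c d) = ennreal (\<Prod>b\<in>Basis. (d - c) \<bullet> b)" .
qed simp

context framed_curve
begin

text \<open>The remainder w is orthogonal to the tangent, hence in the span of the normals, and
  orthogonal to each normal, hence to itself.\<close>

lemma frame_expansion:
  assumes s: "s \<in> {0..l}"
  shows "v = (v \<bullet> T s) *\<^sub>R T s + offset s (\<chi> i. v \<bullet> N i s)"
proof -
  define w where "w = v - (v \<bullet> T s) *\<^sub>R T s - offset s (\<chi> i. v \<bullet> N i s)"
  have wT: "w \<bullet> T s = 0" by (simp add: w_def inner_diff_left T_T[OF s] offset_T[OF s])
  have wN: "w \<bullet> N i s = 0" for i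
    using N_T[OF s, of i] by (simp add: w_def inner_diff_left offset_N[OF s] inner_commute[of "T s" "N i s"])
  have "orthogonal w w"
    by (rule orthogonal_to_span[OF N_span[OF s wT]]) (auto simp: orthogonal_def wN)
  then have "w = 0" by (simp add: orthogonal_def)
  then show ?thesis by (simp add: w_def algebra_simps)
qed

text \<open>Differentiate \<open>N i t \<bullet> T t = 0\<close>; derivatives within a nondegenerate
  closed interval are unique also at its ends.\<close>

lemma dN_T:
  assumes s: "s \<in> {0..l}"
  shows "dN i s \<bullet> T s = - kappa s $ i"
proof -
  have "((\<lambda>t. N i t \<bullet> T t) has_vector_derivative N i s \<bullet> dT s + dN i s \<bullet> T s) (at s within {0..l})"
    by (rule bounded_bilinear.has_vector_derivative[OF bounded_bilinear_inner deriv_N[OF s] deriv_T[OF s]])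
  moreover have "((\<lambda>t. N i t \<bullet> T t) has_vector_derivative 0) (at s within {0..l})"
    by (rule has_vector_derivative_transform[OF s _ has_vector_derivative_const[of 0]]) (simp add: N_T)
  ultimately have "N i s \<bullet> dT s + dN i s \<bullet> T s = 0"
    using s l_pos by (intro vector_derivative_unique_within_closed_interval[of 0 l s]) auto
  then show ?thesis by (simp add: kappa_def inner_commute)
qed

definition dnu :: "real \<Rightarrow> real ^ 'n \<Rightarrow> real \<times> (real ^ 'n) \<Rightarrow> real ^ 'd" where
  "dnu s u = (\<lambda>(a, v). a *\<^sub>R (T s + (\<Sum>i\<in>UNIV. u $ i *\<^sub>R dN i s)) + offset s v)"

lemma deriv_nu:
  assumes s: "s \<in> {0..l}"
  shows "((\<lambda>(s, u). nu s u) has_derivative dnu s u) (at (s, u) within {0..l} \<times> UNIV)"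
proof -
  let ?D = "{0..l} \<times> (UNIV :: (real ^ 'n) set)"
  have fst: "((fst :: real \<times> (real ^ 'n) \<Rightarrow> real) has_derivative fst) (at (s, u) within ?D)"
    by (intro bounded_linear_imp_has_derivative bounded_linear_fst)
  have \<Gamma>: "((\<lambda>z. \<Gamma> (fst z)) has_derivative (\<lambda>h. fst h *\<^sub>R T s)) (at (s, u) within ?D)"
    using has_derivative_in_compose2[OF deriv_curve[unfolded has_vector_derivative_def] _ _ fst] s by auto
  have N: "((\<lambda>z. N i (fst z)) has_derivative (\<lambda>h. fst h *\<^sub>R dN i s)) (at (s, u) within ?D)" for i
    using has_derivative_in_compose2[OF deriv_N[unfolded has_vector_derivative_def] _ _ fst] s by auto
  have comp: "((\<lambda>z :: real \<times> (real ^ 'n). snd z $ i) has_derivative (\<lambda>h. snd h $ i)) (at (s, u) within ?D)" for i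
    by (intro bounded_linear_imp_has_derivative
        bounded_linear_compose[OF bounded_linear_vec_nth bounded_linear_snd])
  have "((\<lambda>z. \<Gamma> (fst z) + (\<Sum>i\<in>UNIV. (snd z $ i) *\<^sub>R N i (fst z))) has_derivative
      (\<lambda>h. fst h *\<^sub>R T s + (\<Sum>i\<in>UNIV. u $ i *\<^sub>R (fst h *\<^sub>R dN i s) + (snd h $ i) *\<^sub>R N i s)))
      (at (s, u) within ?D)"
    using has_derivative_add[OF \<Gamma> has_derivative_sum[OF has_derivative_scaleR[OF comp N]]] by simp
  also have "(\<lambda>h. fst h *\<^sub>R T s + (\<Sum>i\<in>UNIV. u $ i *\<^sub>R (fst h *\<^sub>R dN i s) + (snd h $ i) *\<^sub>R N i s)) = dnu s u"
    by (auto simp: dnu_def offset_def sum.distrib scaleR_sum_right scaleR_add_right mult.commute)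
  also have "(\<lambda>z. \<Gamma> (fst z) + (\<Sum>i\<in>UNIV. (snd z $ i) *\<^sub>R N i (fst z))) = (\<lambda>(s, u). nu s u)"
    by (auto simp: nu_def offset_def)
  finally show ?thesis .
qed

text \<open>Modulo the span of the normal columns, the column \<open>\<partial>\<nu>/\<partial>s\<close> is \<open>jac s u\<close> times the
  tangent, so the Jacobian determinant is \<open>jac s u\<close> times that of an orthogonal matrix.\<close>

lemma det_dnu:
  fixes L1 :: "real ^ ('n suc_index) \<Rightarrow> real \<times> (real ^ 'n)" and L2 :: "real ^ 'd \<Rightarrow> real ^ ('n suc_index)"
  assumes s: "s \<in> {0..l}"
    and L1: "linear L1" "bij_betw L1 Basis Basis" and L2: "linear L2" "bij_betw L2 Basis Basis"
  shows "\<bar>det (matrix (L2 \<circ> dnu s u \<circ> L1))\<bar> = \<bar>jac s u\<bar>"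
proof -
  have img: "L1 ` Basis = Basis" using L1(2) by (simp add: bij_betw_def)
  \<comment> \<open>\<open>m0\<close> is the coordinate that \<open>L1\<close> sends to the
    s-direction; \<open>r\<close> below matches the other coordinates with the normal
    directions.\<close>
  have "(1, 0) \<in> (Basis :: (real \<times> (real ^ 'n)) set)" by (simp add: Basis_prod_def)
  then obtain m0 where m0: "L1 (axis m0 1) = (1, 0)"
    unfolding img[symmetric] by (auto simp: Basis_vec_def)
  have inj: "L1 (axis m 1) \<noteq> L1 (axis m' 1)" if "m \<noteq> m'" for m m' :: "'n suc_index"
    using L1(2) that unfolding bij_betw_def inj_on_def by (metis axis_eq_axis axis_in_Basis_iff one_neq_zero Basis_real_def singletonI)
  have "\<exists>i. L1 (axis m 1) = (0, axis i 1)" if m: "m \<noteq> m0" for m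
  proof -
    have "L1 (axis m 1) \<in> Basis" using img by auto
    moreover have "L1 (axis m 1) \<noteq> (1, 0)" using inj[OF m] m0 by simp
    ultimately show ?thesis by (auto simp: Basis_prod_def Basis_vec_def)
  qed
  then obtain r where r: "\<And>m. m \<noteq> m0 \<Longrightarrow> L1 (axis m 1) = (0, axis (r m) 1)" by metis
  have r_inj: "r m \<noteq> r m'" if "m \<noteq> m0" "m' \<noteq> m0" "m \<noteq> m'" for m m'
    using inj[OF that(3)] r that by auto
  have r_surj: "\<exists>m. m \<noteq> m0 \<and> r m = i" for i
  proof -
    have "(0, axis i 1) \<in> (Basis :: (real \<times> (real ^ 'n)) set)" by (simp add: Basis_prod_def)
    then obtain m where m: "L1 (axis m 1) = (0, axis i 1)"
      unfolding img[symmetric] by (auto simp: Basis_vec_def)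
    then have "m \<noteq> m0" using m0 by auto
    then show ?thesis using r[of m] m by (auto simp: axis_eq_axis)
  qed
  have offset_axis: "offset s (axis i 1) = N i s" for i
    by (simp add: offset_def axis_def if_distrib[of "\<lambda>c. c *\<^sub>R _"] cong: if_cong)
  define w where "w = T s + (\<Sum>i\<in>UNIV. u $ i *\<^sub>R dN i s)"
  define B where "B = (\<chi> m. L2 (if m = m0 then T s else N (r m) s))"
  define C where "C = (\<chi> m. if m = m0 then jac s u *s L2 (T s) else L2 (N (r m) s))"
  define y where "y = offset s (\<chi> i. w \<bullet> N i s)"
  have wT: "w \<bullet> T s = jac s u"
    by (simp add: w_def inner_add_left inner_sum_left T_T[OF s] dN_T[OF s] jac_def inner_vec_def[of u] sum_negf)
  have w: "w = jac s u *\<^sub>R T s + y"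
    using frame_expansion[OF s, of w] unfolding wT y_def .
  have col: "(L2 \<circ> dnu s u \<circ> L1) (axis m 1) = (if m = m0 then L2 w else L2 (N (r m) s))" for m
    using m0 r[of m] by (simp add: dnu_def w_def offset_axis offset_zero)
  have Lw: "L2 w = jac s u *s L2 (T s) + L2 y"
    by (simp add: w linear_add[OF L2(1)] linear_scale[OF L2(1)] scalar_mult_eq_scaleR)
  have rowC: "row k C = C $ k" for k by (simp add: row_def vec_eq_iff)
  have "L2 y \<in> vec.span {row j C |j. j \<noteq> m0}"
  proof -
    have "L2 y = (\<Sum>i\<in>UNIV. (w \<bullet> N i s) *s L2 (N i s))"
      by (simp add: y_def offset_def linear_sum[OF L2(1)] linear_scale[OF L2(1)] scalar_mult_eq_scaleR)
    moreover have "L2 (N i s) \<in> {row j C |j. j \<noteq> m0}" for i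
    proof -
      obtain m where "m \<noteq> m0" "r m = i" using r_surj by blast
      then have "L2 (N i s) = row m C" unfolding rowC by (simp add: C_def)
      then show ?thesis using \<open>m \<noteq> m0\<close> by blast
    qed
    ultimately show ?thesis by (simp only:) (intro vec.span_sum vec.span_scale vec.span_base)
  qed
  from det_row_span[OF this]
  have "det (\<chi> k. if k = m0 then row m0 C + L2 y else row k C) = det C" .
  moreover have "(\<chi> k. if k = m0 then row m0 C + L2 y else row k C) = transpose (matrix (L2 \<circ> dnu s u \<circ> L1))"
    unfolding vec_eq_iff transpose_def matrix_def rowC vec_lambda_beta col by (simp add: C_def Lw)
  ultimately have 1: "det (matrix (L2 \<circ> dnu s u \<circ> L1)) = det C" by (simp add: det_transpose)
  have "det C = jac s u * det B"
    using det_row_mul[of m0 "jac s u" "\<lambda>m. L2 (T s)" "\<lambda>m. L2 (N (r m) s)"]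
    by (simp add: C_def B_def if_distrib[of L2] cong: if_cong)
  moreover have "\<bar>det B\<bar> = 1"
  proof -
    have "orthogonal_matrix B"
      unfolding orthogonal_matrix_orthonormal_rows
    proof (intro conjI allI impI)
      have rowB: "row k B = B $ k" for k by (simp add: row_def vec_eq_iff)
      have BB: "row i B \<bullet> row j B = (if i = m0 then T s else N (r i) s) \<bullet> (if j = m0 then T s else N (r j) s)" for i j
        unfolding rowB by (simp only: B_def vec_lambda_beta basis_map_inner[OF L2])
      show "norm (row i B) = 1" for i
        unfolding norm_eq_1 BB by (simp add: T_T[OF s] N_N[OF s])
      show "orthogonal (row i B) (row j B)" if "i \<noteq> j" for i j
      proof -
        have "T s \<bullet> N k s = 0" for k using N_T[OF s, of k] by (simp add: inner_commute)
        then show ?thesis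
          unfolding orthogonal_def BB using that r_inj[of i j] by (auto simp: N_T[OF s] N_orth[OF s])
      qed
    qed
    then have "det B = 1 \<or> det B = - 1" by (rule det_orthogonal_matrix)
    then show ?thesis by auto
  qed
  ultimately show ?thesis using 1 by (simp add: abs_mult)
qed

end

section \<open>Change of variables to normal coordinates\<close>

context framed_curve
begin

text \<open>Curve and frame are controlled only on \<open>{0..l}\<close>. Composed with this
  retraction they become continuous, hence Borel, on the whole line and keep their values on the
  interval.\<close>

definition clamp_param :: "real \<Rightarrow> real" where
  "clamp_param s = max 0 (min l s)"

lemma clamp_param_range: "clamp_param s \<in> {0..l}"
  using l_pos by (auto simp: clamp_param_def)

lemma clamp_param_id: "s \<in> {0..l} \<Longrightarrow> clamp_param s = s"
  by (auto simp: clamp_param_def)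

lemma cont_clamp_param: "continuous_on A clamp_param"
  unfolding clamp_param_def by (intro continuous_intros)

lemma cont_nu_clamp: "continuous_on UNIV (\<lambda>z. nu (clamp_param (fst z)) (snd z))"
proof -
  have "continuous_on UNIV (\<lambda>z. (\<lambda>(s, u). nu s u) (clamp_param (fst z), snd z))"
    by (rule continuous_on_compose2[OF cont_nu])
       (auto intro!: continuous_intros continuous_on_compose2[OF cont_clamp_param] simp: clamp_param_range simp del: atLeastAtMost_iff)
  then show ?thesis by simp
qed

lemma cont_jac_clamp: "continuous_on UNIV (\<lambda>z. jac (clamp_param (fst z)) (snd z))"
  unfolding jac_def
  by (intro continuous_intros continuous_on_compose2[OF cont_kappa] continuous_on_compose2[OF cont_clamp_param])
     (auto simp: clamp_param_range simp del: atLeastAtMost_iff)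

lemma nu_clamp_measurable [measurable]:
  "(\<lambda>z. nu (clamp_param (fst z)) (snd z)) \<in> borel_measurable borel"
  using cont_nu_clamp by (rule borel_measurable_continuous_onI)

lemma jac_clamp_measurable [measurable]:
  "(\<lambda>z. jac (clamp_param (fst z)) (snd z)) \<in> borel_measurable borel"
  using cont_jac_clamp by (rule borel_measurable_continuous_onI)

lemma curve_clamp_measurable [measurable]: "(\<lambda>s. \<Gamma> (clamp_param s)) \<in> borel_measurable borel"
  by (intro borel_measurable_continuous_onI continuous_on_compose2[OF cont_curve cont_clamp_param])
     (auto simp: clamp_param_range simp del: atLeastAtMost_iff)

definition tube :: "(real \<times> (real ^ 'n)) set" where
  "tube = {(s, u). s \<in> {0..l} \<and> u \<in> slice s}"

lemma tube_borel [measurable]: "tube \<in> sets borel"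
proof -
  have [measurable]: "(fst :: real \<times> (real ^ 'n) \<Rightarrow> real) \<in> borel_measurable borel"
    by (intro borel_measurable_continuous_onI continuous_intros)
  have "tube = {z \<in> space borel. fst z \<in> {0..l} \<and> index (nu (clamp_param (fst z)) (snd z)) = fst z \<and>
      nu (clamp_param (fst z)) (snd z) \<notin> amb}"
    by (auto simp: tube_def transverse_range_def normal_coord_map_nu clamp_param_id)
  also have "\<dots> \<in> sets borel"
    by measurable
  finally show ?thesis .
qed

text \<open>The image point determines s as its only closest parameter, and then u by the frame
  coordinates of the residual.\<close>

lemma inj_on_nu: "inj_on (\<lambda>(s, u). nu s u) tube"
proof (rule inj_onI, clarify)
  fix s u s' u' assume *: "(s, u) \<in> tube" "(s', u') \<in> tube" "nu s u = nu s' u'"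
  then have s: "s \<in> {0..l}" and "cp (nu s u) = {s}" "cp (nu s' u') = {s'}"
    by (auto simp: tube_def slice_iff)
  then have "s = s'" using *(3) by auto
  then have "offset s u = offset s u'" using *(3) by (simp add: nu_def)
  then have "u $ i = u' $ i" for i using offset_N[OF s] by metis
  then show "s = s' \<and> u = u'" using \<open>s = s'\<close> by (simp add: vec_eq_iff)
qed

text \<open>Without a tangential part the frame expansion of the residual consists of normals alone,
  and its coefficients are u.\<close>

lemma in_nu_tube:
  assumes "x \<notin> amb" "tangential x (index x) = 0"
  obtains u where "(index x, u) \<in> tube" "x = nu (index x) u"
proof -
  let ?s = "index x"
  let ?u = "\<chi> i. (x - \<Gamma> ?s) \<bullet> N i ?s"
  have "x - \<Gamma> ?s = offset ?s ?u"
    using frame_expansion[OF index_range, of "x - \<Gamma> ?s" x] assms(2) by (simp add: tangential_def)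
  then have x: "x = nu ?s ?u" by (simp add: nu_def algebra_simps)
  have "cp (nu ?s ?u) = {?s}" using assms(1) unfolding x[symmetric] not_amb_iff .
  then have "(?s, ?u) \<in> tube" using index_range[of x] by (simp add: tube_def slice_iff)
  then show ?thesis using x by (rule that)
qed

lemma jac_nonneg_tube: "(s, u) \<in> tube \<Longrightarrow> 0 \<le> jac s u"
  using jac_nonneg[of s u] by (auto simp: tube_def slice_iff)

text \<open>The integrand in normal coordinates, extended by 0 off \<open>tube\<close> and clamped
  so that it is Borel on the full product space.\<close>

definition pullback :: "(real ^ 'd \<Rightarrow> real ^ 'k) \<Rightarrow> real \<times> (real ^ 'n) \<Rightarrow> real ^ 'k" where
  "pullback f z = indicator tube z *\<^sub>R (jac (clamp_param (fst z)) (snd z) *\<^sub>R f (nu (clamp_param (fst z)) (snd z)))"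

lemma pullback_eq: "pullback f (s, u) = indicator tube (s, u) *\<^sub>R (jac s u *\<^sub>R f (nu s u))"
proof (cases "(s, u) \<in> tube")
  case True
  then have "clamp_param s = s" by (intro clamp_param_id) (simp add: tube_def)
  then show ?thesis by (simp add: pullback_def)
qed (simp add: pullback_def)

text \<open>By the hypothesis \<open>normal\<close>, the image of \<open>tube\<close> contains every
  unambiguous point where f is nonzero, so what it misses is null. On \<open>tube\<close> the
  Jacobian is nonnegative and equals the absolute determinant.\<close>

lemma change_of_variables_nu:
  fixes f :: "real ^ 'd \<Rightarrow> real ^ 'k"
  assumes f: "integrable lborel f"
    and normal: "\<And>x. x \<notin> amb \<Longrightarrow> f x \<noteq> 0 \<Longrightarrow> tangential x (index x) = 0"
  shows "integrable lborel (pullback f)" "integral\<^sup>L lborel (pullback f) = integral\<^sup>L lborel f"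
proof -
  have [measurable]: "f \<in> borel_measurable borel" using f by auto
  have "DIM(real ^ ('n suc_index)) = DIM(real \<times> (real ^ 'n))" by (simp add: card_suc_index)
  then obtain L1 :: "real ^ ('n suc_index) \<Rightarrow> real \<times> (real ^ 'n)" and L1' where
    L1: "linear L1" "bij_betw L1 Basis Basis" "\<And>x. L1' (L1 x) = x" "\<And>y. L1 (L1' y) = y"
    by (rule ex_basis_isometry) blast
  have "DIM(real ^ 'd) = DIM(real ^ ('n suc_index))" by (simp add: card_suc_index dim_eq)
  then obtain L2 :: "real ^ 'd \<Rightarrow> real ^ ('n suc_index)" and L2' where
    L2: "linear L2" "bij_betw L2 Basis Basis" and L2': "linear L2'" "bij_betw L2' Basis Basis"
    and L22: "\<And>x. L2' (L2 x) = x" "\<And>y. L2 (L2' y) = y"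
    by (rule ex_basis_isometry) blast
  have blin: "bounded_linear L1" "bounded_linear L2" "bounded_linear L2'"
    using L1 L2 L2' by (simp_all add: linear_conv_bounded_linear)
  have [measurable]: "L1 \<in> borel_measurable borel" "L2 \<in> borel_measurable borel" "L2' \<in> borel_measurable borel"
    using blin by (auto intro!: borel_measurable_continuous_onI linear_continuous_on)
  define S where "S = L1 -` tube"
  \<comment> \<open>The normal coordinate map read as a self-map of one vector space, so that its
    derivative has a square matrix.\<close>
  define G where "G = L2 \<circ> (\<lambda>(s, u). nu s u) \<circ> L1"
  define G' where "G' z = L2 \<circ> dnu (fst (L1 z)) (snd (L1 z)) \<circ> L1" for z
  define h where "h = f \<circ> L2'"
  have S_borel: "S \<in> sets borel"
    using measurable_sets_borel[of L1 borel tube] unfolding S_def by auto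
  then have S: "S \<in> sets lebesgue" by auto
  have der: "(G has_derivative G' z) (at z within S)" if "z \<in> S" for z
  proof -
    have z: "L1 z \<in> tube" using that by (simp add: S_def)
    have s: "fst (L1 z) \<in> {0..l}" using z by (auto simp: tube_def split_beta)
    have "((\<lambda>(s, u). nu s u) has_derivative dnu (fst (L1 z)) (snd (L1 z))) (at (L1 z) within {0..l} \<times> UNIV)"
      using deriv_nu[OF s, of "snd (L1 z)"] by simp
    then have 1: "((\<lambda>(s, u). nu s u) has_derivative dnu (fst (L1 z)) (snd (L1 z))) (at (L1 z) within L1 ` S)"
      by (rule has_derivative_subset) (auto simp: S_def tube_def)
    have "(((\<lambda>(s, u). nu s u) \<circ> L1) has_derivative (dnu (fst (L1 z)) (snd (L1 z)) \<circ> L1)) (at z within S)"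
      by (rule diff_chain_within[OF bounded_linear_imp_has_derivative[OF blin(1)] 1])
    from diff_chain_within[OF this bounded_linear_imp_has_derivative[OF blin(2)]]
    show ?thesis unfolding G_def G'_def comp_assoc .
  qed
  have injG: "inj_on G S"
  proof (rule inj_onI)
    fix y z assume yz: "y \<in> S" "z \<in> S" "G y = G z"
    then have "(\<lambda>(s, u). nu s u) (L1 y) = (\<lambda>(s, u). nu s u) (L1 z)"
      unfolding G_def comp_apply by (metis L22(1))
    then have "L1 y = L1 z" using yz inj_onD[OF inj_on_nu] by (auto simp: S_def)
    then show "y = z" by (metis L1(3))
  qed
  have det: "\<bar>det (matrix (G' z))\<bar> = jac (fst (L1 z)) (snd (L1 z))" if "z \<in> S" for z
  proof -
    have z: "L1 z \<in> tube" using that by (simp add: S_def)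
    then have s: "fst (L1 z) \<in> {0..l}" by (auto simp: tube_def split_beta)
    have "0 \<le> jac (fst (L1 z)) (snd (L1 z))" using jac_nonneg_tube[of "fst (L1 z)" "snd (L1 z)"] z by simp
    then show ?thesis unfolding G'_def det_dnu[OF s L1(1,2) L2] by simp
  qed
  have h_int: "integrable lborel h" "integral\<^sup>L lborel h = integral\<^sup>L lborel f"
  proof -
    have "integrable (distr lborel borel L2') f" using f by (simp add: lborel_distr_basis_map[OF L2'])
    then show "integrable lborel h" unfolding h_def comp_def by (subst (asm) integrable_distr_eq) auto
    have "integral\<^sup>L lborel f = integral\<^sup>L (distr lborel borel L2') f" by (simp add: lborel_distr_basis_map[OF L2'])
    also have "\<dots> = integral\<^sup>L lborel h" unfolding h_def comp_def by (subst integral_distr) auto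
    finally show "integral\<^sup>L lborel h = integral\<^sup>L lborel f" by simp
  qed
  have [measurable]: "h \<in> borel_measurable borel" unfolding h_def comp_def by measurable
  have leb: "integrable lebesgue h" "integral\<^sup>L lebesgue h = integral\<^sup>L lborel f"
    using h_int by (simp_all add: integrable_completion integral_completion)
  have abs_UNIV: "h absolutely_integrable_on UNIV" using leb by (simp add: set_integrable_def)
  have int_UNIV: "integral UNIV h = integral\<^sup>L lborel f"
    using set_lebesgue_integral_eq_integral(2)[OF abs_UNIV] leb by (simp add: set_lebesgue_integral_def)
  have neg: "negligible {x \<in> UNIV - G ` S. h x \<noteq> 0}" "negligible {x \<in> G ` S - UNIV. h x \<noteq> 0}"
  proof -
    have "{x \<in> UNIV - G ` S. h x \<noteq> 0} \<subseteq> L2' -` amb"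
    proof
      fix y assume y: "y \<in> {x \<in> UNIV - G ` S. h x \<noteq> 0}"
      show "y \<in> L2' -` amb"
      proof (rule ccontr)
        assume "y \<notin> L2' -` amb"
        then have na: "L2' y \<notin> amb" by simp
        have "tangential (L2' y) (index (L2' y)) = 0"
          using y by (intro normal[OF na]) (simp add: h_def)
        from in_nu_tube[OF na this] obtain u where
          u: "(index (L2' y), u) \<in> tube" "L2' y = nu (index (L2' y)) u" by blast
        define z where "z = L1' (index (L2' y), u)"
        have "L1 z = (index (L2' y), u)" by (simp add: z_def L1)
        then have "z \<in> S" "G z = y" using u L22 by (auto simp: S_def G_def)
        then show False using y by blast
      qed
    qed
    moreover have "negligible (L2' -` amb)"
    proof -
      have "emeasure lborel (L2' -` amb) = emeasure (distr lborel borel L2') amb"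
        by (simp add: emeasure_distr)
      also have "\<dots> = 0" using amb_null by (simp add: lborel_distr_basis_map[OF L2'] null_sets_def)
      finally have "L2' -` amb \<in> null_sets lborel"
        using measurable_sets_borel[of L2' borel amb] by (auto simp: null_sets_def)
      then show ?thesis by (simp add: negligible_iff_null_sets null_sets_completionI)
    qed
    ultimately show "negligible {x \<in> UNIV - G ` S. h x \<noteq> 0}" using negligible_subset by blast
    show "negligible {x \<in> G ` S - UNIV. h x \<noteq> 0}" by simp
  qed
  have "h absolutely_integrable_on G ` S \<and> integral (G ` S) h = integral\<^sup>L lborel f"
    using abs_UNIV int_UNIV absolutely_integrable_spike_set_eq[OF neg] integral_spike_set[OF neg] by simp
  then have cov: "(\<lambda>z. \<bar>det (matrix (G' z))\<bar> *\<^sub>R h (G z)) absolutely_integrable_on S"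
     "integral S (\<lambda>z. \<bar>det (matrix (G' z))\<bar> *\<^sub>R h (G z)) = integral\<^sup>L lborel f"
    using has_absolute_integral_change_of_variables[OF S der injG] by blast+
  have eq: "indicator S z *\<^sub>R (\<bar>det (matrix (G' z))\<bar> *\<^sub>R h (G z)) = pullback f (L1 z)" for z
  proof (cases "z \<in> S")
    case True
    then have "L1 z \<in> tube" by (simp add: S_def)
    then show ?thesis using True pullback_eq[of f "fst (L1 z)" "snd (L1 z)"]
      by (simp add: det[OF True] h_def G_def L22 split_beta)
  next
    case False
    then have "L1 z \<notin> tube" by (simp add: S_def)
    then show ?thesis using False by (simp add: pullback_def)
  qed
  have pm[measurable]: "pullback f \<in> borel_measurable borel"
    unfolding pullback_def[abs_def] by measurable
  have 1: "integrable lebesgue (\<lambda>z. pullback f (L1 z))"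
    using cov(1) unfolding set_integrable_def eq .
  have "integral\<^sup>L lebesgue (\<lambda>z. pullback f (L1 z)) = integral\<^sup>L lborel f"
    using set_lebesgue_integral_eq_integral(2)[OF cov(1)] cov(2) unfolding set_lebesgue_integral_def eq by simp
  then have 2: "integrable lborel (\<lambda>z. pullback f (L1 z))" "integral\<^sup>L lborel (\<lambda>z. pullback f (L1 z)) = integral\<^sup>L lborel f"
    using 1 by (simp_all add: integrable_completion integral_completion)
  have "integrable (distr lborel borel L1) (pullback f)"
    using 2(1) by (subst integrable_distr_eq) auto
  then show "integrable lborel (pullback f)" by (simp add: lborel_distr_basis_map[OF L1(1,2)])
  have "integral\<^sup>L lborel (pullback f) = integral\<^sup>L (distr lborel borel L1) (pullback f)"
    by (simp add: lborel_distr_basis_map[OF L1(1,2)])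
  also have "\<dots> = integral\<^sup>L lborel f" using 2(2) by (subst integral_distr) auto
  finally show "integral\<^sup>L lborel (pullback f) = integral\<^sup>L lborel f" .
qed

lemma integral_normal_coordinates:
  fixes f :: "real ^ 'd \<Rightarrow> real ^ 'k"
  assumes f: "integrable lborel f"
    and normal: "\<And>x. x \<notin> amb \<Longrightarrow> f x \<noteq> 0 \<Longrightarrow> tangential x (index x) = 0"
  shows "integrable lborel (\<lambda>s. \<integral>u. pullback f (s, u) \<partial>lborel)"
    "(\<integral>x. f x \<partial>lborel) = (\<integral>s. (\<integral>u. pullback f (s, u) \<partial>lborel) \<partial>lborel)"
proof -
  have i: "integrable (lborel \<Otimes>\<^sub>M lborel) (pullback f)"
    using change_of_variables_nu(1)[OF assms] by (simp add: lborel_prod)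
  show "integrable lborel (\<lambda>s. \<integral>u. pullback f (s, u) \<partial>lborel)"
    using lborel_pair.integrable_fst'[OF i] .
  show "(\<integral>x. f x \<partial>lborel) = (\<integral>s. (\<integral>u. pullback f (s, u) \<partial>lborel) \<partial>lborel)"
    using lborel_pair.integral_fst'[OF i] change_of_variables_nu(2)[OF assms] by (simp add: lborel_prod)
qed

end

section \<open>Slices of the density\<close>

text \<open>\<open>normal_at_index\<close> is the geometric content taken from the diffeomorphism
  hypothesis. It includes points of \<open>K\<close> whose closest point is an end of the curve, and
  so excludes caps of positive measure projecting to an end.\<close>

locale density_along_curve = framed_curve \<Gamma> T dT l N dN
  for \<Gamma> T dT :: "real \<Rightarrow> real ^ 'd" and l :: real and N dN :: "'n::finite \<Rightarrow> real \<Rightarrow> real ^ 'd" +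
  fixes p :: "real ^ 'd \<Rightarrow> real" and K :: "(real ^ 'd) set"
  assumes cont_p: "continuous_on UNIV p"
    and p_nonneg: "\<And>x. 0 \<le> p x"
    and p_pos_iff: "\<And>x. 0 < p x \<longleftrightarrow> x \<in> interior K"
    and K_compact: "compact K"
    and normal_at_index: "\<And>x. x \<in> K - amb \<Longrightarrow> tangential x (index x) = 0"
begin

lemma p_measurable [measurable]: "p \<in> borel_measurable borel"
  using cont_p by (rule borel_measurable_continuous_onI)

lemma p_eq_0: "x \<notin> interior K \<Longrightarrow> p x = 0"
  using p_pos_iff[of x] p_nonneg[of x] by simp

lemma K_bounded:
  obtains a where "\<And>x. x \<in> K \<Longrightarrow> norm x \<le> a"
  using compact_imp_bounded[OF K_compact] unfolding bounded_iff by blast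

text \<open>The norm of u is the distance from \<open>nu s u\<close> to \<open>\<Gamma> s\<close>,
  both of which lie in bounded sets when p does not vanish. One radius thus serves all
  slices.\<close>

lemma offset_bounded:
  obtains r where "\<And>s u. s \<in> {0..l} \<Longrightarrow> p (nu s u) \<noteq> 0 \<Longrightarrow> norm u \<le> r"
proof -
  obtain a where a: "\<And>x. x \<in> K \<Longrightarrow> norm x \<le> a"
    using K_bounded by blast
  obtain b where b: "\<And>s. s \<in> {0..l} \<Longrightarrow> norm (\<Gamma> s) \<le> b"
    using curve_bounded by blast
  show ?thesis
  proof (rule that[of "a + b"])
    fix s u assume s: "s \<in> {0..l}" and p: "p (nu s u) \<noteq> 0"
    then have "nu s u \<in> K" using p_eq_0 interior_subset by blast
    have "norm u = norm (nu s u - \<Gamma> s)" by (simp add: nu_def norm_offset[OF s])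
    also have "\<dots> \<le> norm (nu s u) + norm (\<Gamma> s)" by (rule norm_triangle_ineq4)
    finally show "norm u \<le> a + b" using a[OF \<open>nu s u \<in> K\<close>] b[OF s] by linarith
  qed
qed

definition slice_density :: "real \<Rightarrow> real ^ 'n \<Rightarrow> real" where
  "slice_density s u = indicator (slice s) u * p (nu s u)"

lemma slice_density_nonneg: "0 \<le> slice_density s u"
  by (simp add: slice_density_def p_nonneg)

lemma slice_density_le: "slice_density s u \<le> p (nu s u)"
  using p_nonneg by (simp add: slice_density_def indicator_def)

lemma slice_borel:
  assumes "s \<in> {0..l}" shows "slice s \<in> sets borel"
proof -
  have "tube \<in> sets ((borel :: real measure) \<Otimes>\<^sub>M (borel :: (real ^ 'n) measure))"
    using tube_borel unfolding borel_prod .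
  then have "Pair s -` tube \<in> sets borel" by (rule sets_Pair1)
  moreover have "Pair s -` tube = slice s" using assms unfolding tube_def by auto
  ultimately show ?thesis by simp
qed

lemma cont_nu_slice: "s \<in> {0..l} \<Longrightarrow> continuous_on A (nu s)"
  unfolding nu_def[abs_def] offset_def by (intro continuous_intros)

lemma slice_density_measurable:
  assumes s: "s \<in> {0..l}" shows "slice_density s \<in> borel_measurable borel"
proof -
  have [measurable]: "slice s \<in> sets borel" "nu s \<in> borel_measurable borel"
    using slice_borel[OF s] cont_nu_slice[OF s] by (auto intro: borel_measurable_continuous_onI)
  show ?thesis unfolding slice_density_def[abs_def] by measurable
qed

text \<open>C bounds the continuous integrand on the compact set of parameters times
  \<open>cball 0 r\<close>, and p vanishes beyond. The bound does not depend on s, as dominated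
  convergence requires.\<close>

lemma slice_density_dominated:
  fixes \<phi> :: "real \<Rightarrow> real ^ 'n \<Rightarrow> 'a::real_normed_vector"
  assumes \<phi>: "continuous_on ({0..l} \<times> UNIV) (\<lambda>(s, u). \<phi> s u)"
  obtains C r where "\<And>s u. s \<in> {0..l} \<Longrightarrow> norm (slice_density s u *\<^sub>R \<phi> s u) \<le> C * indicator (cball 0 r) u"
proof -
  obtain r where r: "\<And>s u. s \<in> {0..l} \<Longrightarrow> p (nu s u) \<noteq> 0 \<Longrightarrow> norm u \<le> r" using offset_bounded by blast
  have "continuous_on ({0..l} \<times> cball 0 r) (\<lambda>z. p ((\<lambda>(s, u). nu s u) z) *\<^sub>R (\<lambda>(s, u). \<phi> s u) z)"
    by (intro continuous_intros continuous_on_compose2[OF cont_p] continuous_on_subset[OF cont_nu] continuous_on_subset[OF \<phi>]) auto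
  then have "bounded ((\<lambda>z. p ((\<lambda>(s, u). nu s u) z) *\<^sub>R (\<lambda>(s, u). \<phi> s u) z) ` ({0..l} \<times> cball 0 r))"
    by (intro compact_imp_bounded compact_continuous_image compact_Times compact_Icc compact_cball)
  then obtain C where "\<forall>y \<in> (\<lambda>z. p ((\<lambda>(s, u). nu s u) z) *\<^sub>R (\<lambda>(s, u). \<phi> s u) z) ` ({0..l} \<times> cball 0 r). norm y \<le> C"
    by (auto simp only: bounded_iff)
  then have C: "p (nu s u) * norm (\<phi> s u) \<le> C" if "s \<in> {0..l}" "u \<in> cball 0 r" for s u
    using that p_nonneg[of "nu s u"] by force
  show ?thesis
  proof (rule that[of C r])
    fix s u assume s: "s \<in> {0..l}"
    show "norm (slice_density s u *\<^sub>R \<phi> s u) \<le> C * indicator (cball 0 r) u"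
    proof (cases "u \<in> cball 0 r")
      case True
      have "norm (slice_density s u *\<^sub>R \<phi> s u) = slice_density s u * norm (\<phi> s u)"
        using slice_density_nonneg[of s u] by simp
      also have "\<dots> \<le> p (nu s u) * norm (\<phi> s u)"
        by (intro mult_right_mono slice_density_le) simp
      also have "\<dots> \<le> C" by (rule C[OF s True])
      finally show ?thesis using True by simp
    next
      case False
      then have "p (nu s u) = 0" using r[OF s, of u] by auto
      then show ?thesis using False by (simp add: slice_density_def)
    qed
  qed
qed

lemma slice_density_integrable:
  fixes \<phi> :: "real ^ 'n \<Rightarrow> 'a::{banach, second_countable_topology}"
  assumes s: "s \<in> {0..l}" and \<phi>: "continuous_on UNIV \<phi>"
  shows "integrable lborel (\<lambda>u. slice_density s u *\<^sub>R \<phi> u)"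
proof -
  have "continuous_on ({0..l} \<times> UNIV) (\<lambda>(s :: real, u). \<phi> u)"
    unfolding split_beta by (intro continuous_on_compose2[OF \<phi>] continuous_intros) auto
  from slice_density_dominated[OF this] obtain C r where
    C: "\<And>u. norm (slice_density s u *\<^sub>R \<phi> u) \<le> C * indicator (cball 0 r) u" using s by metis
  have [measurable]: "slice_density s \<in> borel_measurable borel" "\<phi> \<in> borel_measurable borel"
    using slice_density_measurable[OF s] \<phi> by (auto intro: borel_measurable_continuous_onI)
  show ?thesis
  proof (rule Bochner_Integration.integrable_bound)
    show "integrable lborel (\<lambda>u. C * indicator (cball 0 r) u :: real)"
      by (intro integrable_mult_right integrable_real_indicator) (auto simp: emeasure_lborel_cball_finite[simplified])
    show "AE u in lborel. norm (slice_density s u *\<^sub>R \<phi> u) \<le> norm (C * indicator (cball 0 r) u)"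
      using C by (auto intro!: AE_I2 intro: order_trans[OF _ abs_ge_self])
  qed measurable
qed

section \<open>Almost every point of a normal hyperplane is regular\<close>

lemma closed_amb_slice: "s \<in> {0..l} \<Longrightarrow> closed {u. s \<in> cp (nu s u) \<and> nu s u \<in> amb_part k n}"
proof -
  assume s: "s \<in> {0..l}"
  have "closed ((\<lambda>u. (nu s u, s)) -` {(x, s). s \<in> cp x})" "closed (nu s -` amb_part k n)"
    by (intro closed_vimage closed_closest_graph closed_amb_part continuous_intros cont_nu_slice[OF s])+
  from closed_Int[OF this] show ?thesis by (simp add: vimage_def Int_def)
qed

text \<open>By \<open>closest_shrink\<close>, a point strictly between \<open>\<Gamma> s\<close> and
  a point with s among its closest parameters is unambiguous, so each ray from 0 meets the set at
  most once. The criterion for such sets asks for closedness, hence the pieces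
  \<open>amb_part\<close>.\<close>

lemma amb_slice_negligible:
  assumes s: "s \<in> {0..l}"
  shows "negligible {u. s \<in> cp (nu s u) \<and> nu s u \<in> amb}"
proof -
  have "negligible {u. s \<in> cp (nu s u) \<and> nu s u \<in> amb_part k n}" for k n
  proof (rule starlike_negligible_strong[OF closed_amb_slice[OF s], where a = 0])
    fix c :: real and u assume c: "0 \<le> c" "c < 1" and u: "0 + u \<in> {u. s \<in> cp (nu s u) \<and> nu s u \<in> amb_part k n}"
    have "cp (\<Gamma> s + c *\<^sub>R offset s u) = {s}"
      using u c by (intro closest_shrink) (auto simp: nu_def)
    then have "nu s (c *\<^sub>R u) \<notin> amb" by (intro closest_singletonD) (simp add: nu_def offset_scale)
    then show "0 + c *\<^sub>R u \<notin> {u. s \<in> cp (nu s u) \<and> nu s u \<in> amb_part k n}"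
      by (auto simp: amb_eq)
  qed
  then have "negligible (\<Union>z\<in>UNIV. {u. s \<in> cp (nu s u) \<and> nu s u \<in> amb_part (fst z) (snd z)})"
    by (intro negligible_countable_Union) auto
  also have "(\<Union>z\<in>UNIV. {u. s \<in> cp (nu s u) \<and> nu s u \<in> amb_part (fst z) (snd z)}) = {u. s \<in> cp (nu s u) \<and> nu s u \<in> amb}"
    unfolding amb_eq by auto blast
  finally show ?thesis .
qed

lemma AE_regular_slice:
  assumes s: "s \<in> {0..l}"
  shows "AE u in lborel. jac s u \<noteq> 0 \<and> (s \<in> cp (nu s u) \<longrightarrow> u \<in> slice s)"
proof -
  \<comment> \<open>A hyperplane if \<open>kappa s\<close> is nonzero, and empty otherwise.\<close>
  have "negligible {u. kappa s \<bullet> u = 1}" by (rule negligible_hyperplane) simp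
  then have "AE u in lebesgue. u \<notin> {u. kappa s \<bullet> u = 1}" "AE u in lebesgue. u \<notin> {u. s \<in> cp (nu s u) \<and> nu s u \<in> amb}"
    using amb_slice_negligible[OF s] by (auto simp only: negligible_iff_null_sets intro: AE_not_in)
  then have "AE u in lborel. u \<notin> {u. kappa s \<bullet> u = 1}" "AE u in lborel. u \<notin> {u. s \<in> cp (nu s u) \<and> nu s u \<in> amb}"
    by (simp_all only: AE_completion_iff)
  then show ?thesis
  proof eventually_elim
    case (elim u)
    have "u \<in> slice s" if "s \<in> cp (nu s u)"
    proof -
      have "nu s u \<notin> amb" using elim that by simp
      then have "cp (nu s u) = {index (nu s u)}" by (simp add: not_amb_iff)
      then show ?thesis using that unfolding slice_iff by auto
    qed
    then show ?case using elim by (auto simp: jac_def inner_commute)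
  qed
qed

lemma slice_density_zero_at_endpoint:
  assumes "s = 0 \<or> s = l"
  shows "AE u in lborel. slice_density s u = 0"
proof -
  have s: "s \<in> {0..l}" using assms l_pos by auto
  from AE_regular_slice[OF s] show ?thesis
  proof eventually_elim
    case (elim u)
    show ?case
    proof (cases "u \<in> slice s")
      case True
      then have "0 \<le> jac s u" by (intro jac_nonneg) (simp add: slice_iff)
      then have "nu s u \<notin> interior K"
        using nu_not_interior_at_endpoint[OF assms True _ normal_at_index amb_negligible] elim by simp
      then show ?thesis by (simp add: slice_density_def p_eq_0)
    qed (simp add: slice_density_def)
  qed
qed

text \<open>A regular u is in one of two stable situations: it lies in the slice with positive
  Jacobian, and \<open>slice_open\<close> keeps it there; or s0 is no closest parameter, and the
  closed graph keeps it out. The factor p is continuous.\<close>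

lemma slice_density_tendsto:
  assumes s0: "0 < s0" "s0 < l" and S: "S \<longlonglongrightarrow> s0" "\<And>n. S n \<in> {0..l}"
    and u: "jac s0 u \<noteq> 0" "s0 \<in> cp (nu s0 u) \<Longrightarrow> u \<in> slice s0"
  shows "(\<lambda>n. slice_density (S n) u) \<longlonglongrightarrow> slice_density s0 u"
proof -
  have s0': "s0 \<in> {0..l}" using s0 by auto
  have SU: "(\<lambda>n. (S n, u)) \<longlonglongrightarrow> (s0, u)" by (intro tendsto_intros S)
  have nu: "(\<lambda>n. nu (S n) u) \<longlonglongrightarrow> nu s0 u"
    using continuous_on_tendsto_compose[OF cont_nu SU] S(2) s0' by auto
  have p: "(\<lambda>n. p (nu (S n) u)) \<longlonglongrightarrow> p (nu s0 u)"
    using continuous_on_tendsto_compose[OF cont_p nu] by simp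
  consider "u \<in> slice s0" | "u \<notin> slice s0" by blast
  then show ?thesis
  proof cases
    case 1
    then have "0 < jac s0 u" using jac_nonneg[of s0 u] u(1) by (simp add: slice_iff)
    from slice_open[OF s0 1 this] have "\<forall>\<^sub>F n in sequentially. u \<in> slice (S n)"
      using SU by (auto simp: filterlim_iff)
    then have "\<forall>\<^sub>F n in sequentially. p (nu (S n) u) = slice_density (S n) u"
      by eventually_elim (simp add: slice_density_def)
    then show ?thesis using Lim_transform_eventually[OF p] 1 by (simp add: slice_density_def)
  next
    case 2
    then have "s0 \<notin> cp (nu s0 u)" using u(2) by blast
    then have "(nu s0 u, s0) \<in> - {(x, s). s \<in> cp x}" by simp
    moreover have "(\<lambda>n. (nu (S n) u, S n)) \<longlonglongrightarrow> (nu s0 u, s0)" by (intro tendsto_intros S nu)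
    ultimately have "\<forall>\<^sub>F n in sequentially. (nu (S n) u, S n) \<in> - {(x, s). s \<in> cp x}"
      using closed_closest_graph by (intro topological_tendstoD) auto
    then have "\<forall>\<^sub>F n in sequentially. 0 = slice_density (S n) u"
      by eventually_elim (auto simp: slice_density_def slice_iff indicator_def)
    from Lim_transform_eventually[OF tendsto_const this] 2 show ?thesis by (simp add: slice_density_def)
  qed
qed

text \<open>The density of the vector measure \<open>B \<mapsto> E[(X - \<pi>(X)) 1\<^sub>B(\<lambda>(X))]\<close>.\<close>

definition deviation :: "real \<Rightarrow> real ^ 'd" where
  "deviation s = (\<integral>u. slice_density s u *\<^sub>R (jac s u *\<^sub>R offset s u) \<partial>lborel)"

lemma cont_jac: "continuous_on ({0..l} \<times> UNIV) (\<lambda>(s, u). jac s u)"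
  unfolding jac_def split_beta
  by (intro continuous_intros continuous_on_compose2[OF cont_kappa]) auto

text \<open>Dominated convergence, with the exceptional null set of the limit parameter s0 alone.
  \<open>slice_open\<close> concerns interior parameters; the end points are settled by
  \<open>deviation_endpoint\<close>.\<close>

lemma cont_deviation: "continuous_on {0<..<l} deviation"
  unfolding continuous_on_sequentially
proof (intro allI ballI impI)
  fix S s0 assume s0: "s0 \<in> {0<..<l}" and S: "(\<forall>n. S n \<in> {0<..<l}) \<and> S \<longlonglongrightarrow> s0"
  have s0': "0 < s0" "s0 < l" "s0 \<in> {0..l}" using s0 by auto
  have Sn: "S n \<in> {0..l}" for n using S by (metis atLeastAtMost_iff greaterThanLessThan_iff less_imp_le)
  let ?\<phi> = "\<lambda>s u. jac s u *\<^sub>R offset s u"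
  have "continuous_on ({0..l} \<times> UNIV) (\<lambda>z. (\<lambda>(s, u). jac s u) z *\<^sub>R (\<lambda>(s, u). offset s u) z)"
    by (intro continuous_intros cont_jac cont_offset)
  then have \<phi>: "continuous_on ({0..l} \<times> UNIV) (\<lambda>(s, u). ?\<phi> s u)" by (simp add: split_beta)
  obtain C r where C: "\<And>s u. s \<in> {0..l} \<Longrightarrow> norm (slice_density s u *\<^sub>R ?\<phi> s u) \<le> C * indicator (cball 0 r) u"
    using slice_density_dominated[OF \<phi>] by blast
  have meas: "(\<lambda>u. slice_density s u *\<^sub>R ?\<phi> s u) \<in> borel_measurable lborel" if s: "s \<in> {0..l}" for s
  proof -
    have [measurable]: "slice_density s \<in> borel_measurable borel" by (rule slice_density_measurable[OF s])
    have "continuous_on UNIV (?\<phi> s)" unfolding jac_def offset_def by (intro continuous_intros)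
    then have [measurable]: "?\<phi> s \<in> borel_measurable borel" by (rule borel_measurable_continuous_onI)
    show ?thesis by measurable
  qed
  have "(\<lambda>n. \<integral>u. slice_density (S n) u *\<^sub>R ?\<phi> (S n) u \<partial>lborel) \<longlonglongrightarrow> (\<integral>u. slice_density s0 u *\<^sub>R ?\<phi> s0 u \<partial>lborel)"
  proof (rule integral_dominated_convergence)
    show "integrable lborel (\<lambda>u. C * indicator (cball 0 r) u :: real)"
      by (intro integrable_mult_right integrable_real_indicator) (auto simp: emeasure_lborel_cball_finite[simplified])
    show "AE u in lborel. (\<lambda>n. slice_density (S n) u *\<^sub>R ?\<phi> (S n) u) \<longlonglongrightarrow> slice_density s0 u *\<^sub>R ?\<phi> s0 u"
      using AE_regular_slice[OF s0'(3)]
    proof eventually_elim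
      case (elim u)
      have 1: "(\<lambda>n. (\<lambda>(s, u). ?\<phi> s u) (S n, u)) \<longlonglongrightarrow> (\<lambda>(s, u). ?\<phi> s u) (s0, u)"
        by (rule continuous_on_tendsto_compose[OF \<phi>]) (use S Sn s0' in \<open>auto intro!: tendsto_intros\<close>)
      have 2: "(\<lambda>n. slice_density (S n) u) \<longlonglongrightarrow> slice_density s0 u"
        by (rule slice_density_tendsto[OF s0'(1,2)]) (use S Sn elim in auto)
      show ?case using tendsto_scaleR[OF 2 1] by simp
    qed
  qed (use meas Sn s0' C in auto)
  then show "(deviation \<circ> S) \<longlonglongrightarrow> deviation s0" by (simp add: deviation_def comp_def)
qed

lemma deviation_endpoint:
  assumes "s = 0 \<or> s = l" shows "deviation s = 0"
proof -
  have "deviation s = (\<integral>u. 0 \<partial>(lborel :: (real ^ 'n) measure))"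
    unfolding deviation_def
    by (intro integral_cong_AE)
       (use slice_density_zero_at_endpoint[OF assms] slice_density_measurable[of s] assms l_pos
        in \<open>auto simp: jac_def offset_def intro!: borel_measurable_scaleR borel_measurable_diff\<close>)
  then show ?thesis by simp
qed

end

section \<open>Transverse moments and the Gram matrix\<close>

lemma invertible_solve:
  fixes A :: "real ^ 'm ^ 'm"
  assumes "invertible A" shows "y = A *v x \<longleftrightarrow> x = matrix_inv A *v y"
proof -
  have "\<exists>B. A ** B = mat 1 \<and> B ** A = mat 1" using assms by (simp add: invertible_def)
  then have "A ** matrix_inv A = mat 1 \<and> matrix_inv A ** A = mat 1"
    unfolding matrix_inv_def by (rule someI_ex)
  then show ?thesis by (metis matrix_vector_mul_assoc matrix_vector_mul_lid)
qed

context density_along_curve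
begin

abbreviation mom :: "real \<Rightarrow> real ^ 'n" where "mom \<equiv> moment_vector p \<Gamma> l N"
abbreviation gram :: "real \<Rightarrow> real ^ 'n ^ 'n" where "gram \<equiv> gram_matrix p \<Gamma> l N"

lemma transverse_moment_eq:
  "transverse_moment p \<Gamma> l N j s = (\<integral>u. slice_density s u * (\<Prod>i\<in>UNIV. (u $ i) ^ j i) \<partial>lborel)"
  unfolding transverse_moment_def set_lebesgue_integral_def normal_coord_map_nu slice_density_def
  by (intro Bochner_Integration.integral_cong refl) (simp add: mult_ac)

lemma prod_unit_index: "(\<Prod>k\<in>UNIV. (u $ k) ^ unit_index i k) = u $ i"
proof -
  have "(\<Prod>k\<in>UNIV. (u $ k) ^ unit_index i k) = (\<Prod>k\<in>UNIV. if k = i then u $ k else 1)"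
    by (intro prod.cong) (auto simp: unit_index_def)
  then show ?thesis by simp
qed

lemma mom_nth: "mom s $ i = (\<integral>u. slice_density s u * u $ i \<partial>lborel)"
  by (simp add: moment_vector_def transverse_moment_eq prod_unit_index)

lemma gram_nth: "gram s $ i $ j = (\<integral>u. slice_density s u * (u $ i * u $ j) \<partial>lborel)"
  by (simp add: gram_matrix_def transverse_moment_eq power_add prod.distrib prod_unit_index)

lemma slice_density_integrable_mult:
  assumes "s \<in> {0..l}" "continuous_on UNIV \<phi>"
  shows "integrable lborel (\<lambda>u. slice_density s u * \<phi> u :: real)"
  using slice_density_integrable[OF assms] by simp

text \<open>The summand 1 of the Jacobian contributes the first moments, and the summand
  \<open>- u \<bullet> kappa s\<close> contributes second moments times curvatures.\<close>

lemma integral_jac_nth: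
  assumes s: "s \<in> {0..l}"
  shows "(\<integral>u. slice_density s u * (jac s u * u $ i) \<partial>lborel) = (mom s - gram s *v kappa s) $ i"
proof -
  have int: "integrable lborel (\<lambda>u. slice_density s u * (u $ i * u $ j))" for j
    by (intro slice_density_integrable_mult[OF s] continuous_intros)
  have int1: "integrable lborel (\<lambda>u. slice_density s u * u $ i)"
    by (intro slice_density_integrable_mult[OF s] continuous_intros)
  have "slice_density s u * (jac s u * u $ i) = slice_density s u * u $ i
      - (\<Sum>j\<in>UNIV. slice_density s u * (u $ i * u $ j) * kappa s $ j)" for u
    by (simp add: jac_def inner_vec_def algebra_simps sum_distrib_left sum_distrib_right)
  then have "(\<integral>u. slice_density s u * (jac s u * u $ i) \<partial>lborel) = (\<integral>u. slice_density s u * u $ i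
      - (\<Sum>j\<in>UNIV. slice_density s u * (u $ i * u $ j) * kappa s $ j) \<partial>lborel)"
    by presburger
  also have "\<dots> = mom s $ i - (\<Sum>j\<in>UNIV. gram s $ i $ j * kappa s $ j)"
    by (simp add: int int1 mom_nth gram_nth Bochner_Integration.integral_diff Bochner_Integration.integral_sum
        Bochner_Integration.integrable_sum)
  finally show ?thesis by (simp add: matrix_vector_mult_def)
qed

lemma deviation_eq:
  assumes s: "s \<in> {0..l}"
  shows "deviation s = offset s (mom s - gram s *v kappa s)"
proof -
  have int: "integrable lborel (\<lambda>u. slice_density s u * (jac s u * u $ i))" for i
    unfolding jac_def by (intro slice_density_integrable_mult[OF s] continuous_intros)
  have "deviation s = (\<integral>u. (\<Sum>i\<in>UNIV. (slice_density s u * (jac s u * u $ i)) *\<^sub>R N i s) \<partial>lborel)"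
    unfolding deviation_def offset_def
    by (intro Bochner_Integration.integral_cong refl) (simp add: scaleR_sum_right)
  also have "\<dots> = (\<Sum>i\<in>UNIV. (\<integral>u. slice_density s u * (jac s u * u $ i) \<partial>lborel) *\<^sub>R N i s)"
    by (subst Bochner_Integration.integral_sum) (use int in auto)
  finally show ?thesis unfolding integral_jac_nth[OF s] offset_def .
qed

lemma deviation_eq_0_iff:
  assumes s: "s \<in> {0..l}"
  shows "deviation s = 0 \<longleftrightarrow> mom s = gram s *v kappa s"
  unfolding deviation_eq[OF s] offset_eq_0_iff[OF s] by simp

lemma nondegenerate_slice_iff:
  "nondegenerate_slice K \<Gamma> l N s \<longleftrightarrow> (\<exists>u\<in>slice s. nu s u \<in> interior K)"
  by (simp add: nondegenerate_slice_def normal_coord_map_nu)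

text \<open>Shrinking \<open>u\<close> slightly towards the curve moves it off the focal set.\<close>

lemma nondegenerate_regular_point:
  assumes s: "s \<in> {0..l}" and nd: "nondegenerate_slice K \<Gamma> l N s"
  obtains u where "0 < s" "s < l" "u \<in> slice s" "0 < jac s u" "nu s u \<in> interior K"
proof -
  obtain u where u: "u \<in> slice s" "nu s u \<in> interior K" using nd nondegenerate_slice_iff by blast
  have cpu: "cp (nu s u) = {s}" using u slice_iff by blast
  have "continuous_on UNIV (\<lambda>c. nu s (c *\<^sub>R u))"
    by (intro continuous_on_compose2[OF cont_nu_slice[OF s]] continuous_intros) auto
  then have "open ((\<lambda>c. nu s (c *\<^sub>R u)) -` interior K)" by (rule open_vimage[rotated]) simp
  moreover have "1 \<in> (\<lambda>c. nu s (c *\<^sub>R u)) -` interior K" using u by simp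
  ultimately obtain e where e: "0 < e" "\<And>c. dist c 1 < e \<Longrightarrow> nu s (c *\<^sub>R u) \<in> interior K"
    unfolding open_dist by blast
  \<comment> \<open>The bound 1/2 keeps c nonnegative, and 1 - e/2 keeps it below 1 but closer to 1
    than e.\<close>
  define c where "c = max (1/2) (1 - e/2)"
  have c: "0 \<le> c" "c < 1" "dist c 1 < e" using e(1) by (auto simp: c_def dist_real_def)
  have "cp (\<Gamma> s + c *\<^sub>R offset s u) = {s}"
    using cpu by (intro closest_shrink[OF _ c(1,2)]) (simp add: nu_def)
  then have 1: "c *\<^sub>R u \<in> slice s" by (simp add: slice_iff nu_def offset_scale)
  have "0 \<le> jac s u" using cpu by (intro jac_nonneg) simp
  then have "0 \<le> c * jac s u" using c(1) by simp
  \<comment> \<open>Along the ray the Jacobian is affine with value 1 on the curve, so for c below 1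
    it exceeds a nonnegative number by 1 - c.\<close>
  moreover have "jac s (c *\<^sub>R u) = (1 - c) + c * jac s u" by (simp add: jac_def algebra_simps)
  ultimately have 2: "0 < jac s (c *\<^sub>R u)" using c(2) by simp
  have 3: "nu s (c *\<^sub>R u) \<in> interior K" using e(2)[OF c(3)] .
  have "\<not> (s = 0 \<or> s = l)"
    using nu_not_interior_at_endpoint[OF _ 1 2 normal_at_index amb_negligible] 3 by blast
  then show ?thesis using that[OF _ _ 1 2 3] s by auto
qed

lemma eventually_in_slice_interior:
  assumes "0 < s" "s < l" "u \<in> slice s" "0 < jac s u" "nu s u \<in> interior K"
  shows "\<forall>\<^sub>F z in nhds (s, u). snd z \<in> slice (fst z) \<and> nu (fst z) (snd z) \<in> interior K"
proof -
  have 1: "\<forall>\<^sub>F z in nhds (s, u). snd z \<in> slice (fst z)" by (rule slice_open[OF assms(1-4)])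
  have "isCont (\<lambda>(s, u). nu s u) (s, u)"
    by (rule continuous_on_interior[OF cont_nu]) (use assms in \<open>auto simp: interior_Times\<close>)
  then have "((\<lambda>(s, u). nu s u) \<longlongrightarrow> nu s u) (nhds (s, u))"
    using tendsto_at_iff_tendsto_nhds[of "\<lambda>(s, u). nu s u" "(s, u)"] by (simp add: isCont_def)
  from topological_tendstoD[OF this open_interior assms(5)]
  have 2: "\<forall>\<^sub>F z in nhds (s, u). nu (fst z) (snd z) \<in> interior K" by (simp add: split_beta)
  show ?thesis using eventually_conj[OF 1 2] .
qed

text \<open>A regular witness u works for all nearby parameters, and s is interior to the interval.
  Openness makes the set Borel, as needed in \<open>AE_invertible_gram\<close>.\<close>

lemma open_nondegenerate: "open {s \<in> {0..l}. nondegenerate_slice K \<Gamma> l N s}"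
proof (subst open_subopen, rule ballI)
  fix s assume "s \<in> {s \<in> {0..l}. nondegenerate_slice K \<Gamma> l N s}"
  then obtain u where u: "0 < s" "s < l" "u \<in> slice s" "0 < jac s u" "nu s u \<in> interior K"
    using nondegenerate_regular_point by blast
  obtain A where A: "open A" "(s, u) \<in> A"
    "\<And>z. z \<in> A \<Longrightarrow> snd z \<in> slice (fst z) \<and> nu (fst z) (snd z) \<in> interior K"
    using eventually_in_slice_interior[OF u] unfolding eventually_nhds by blast
  obtain B C where BC: "open B" "open C" "s \<in> B" "u \<in> C" "B \<times> C \<subseteq> A"
    using open_prod_elim[OF A(1,2)] by (metis mem_Sigma_iff)
  have "t \<in> {s \<in> {0..l}. nondegenerate_slice K \<Gamma> l N s}" if "t \<in> B \<inter> {0<..<l}" for t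
  proof -
    have "(t, u) \<in> A" using that BC by blast
    from A(3)[OF this] have "nondegenerate_slice K \<Gamma> l N t" unfolding nondegenerate_slice_iff by auto
    then show ?thesis using that by auto
  qed
  then show "\<exists>T. open T \<and> s \<in> T \<and> T \<subseteq> {s \<in> {0..l}. nondegenerate_slice K \<Gamma> l N s}"
    using BC u by (intro exI[of _ "B \<inter> {0<..<l}"]) auto
qed

lemma gram_quadratic:
  assumes s: "s \<in> {0..l}"
  shows "v \<bullet> (gram s *v v) = (\<integral>u. slice_density s u * (u \<bullet> v)\<^sup>2 \<partial>lborel)"
proof -
  have int: "integrable lborel (\<lambda>u. slice_density s u * (u $ i * u $ j))" for i j
    by (intro slice_density_integrable_mult[OF s] continuous_intros)
  have "(\<integral>u. slice_density s u * (u \<bullet> v)\<^sup>2 \<partial>lborel)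
      = (\<integral>u. (\<Sum>i\<in>UNIV. \<Sum>j\<in>UNIV. (v $ i * v $ j) * (slice_density s u * (u $ i * u $ j))) \<partial>lborel)"
    by (intro Bochner_Integration.integral_cong refl)
       (simp add: inner_vec_def power2_eq_square sum_product sum_distrib_left mult_ac)
  also have "\<dots> = (\<Sum>i\<in>UNIV. \<Sum>j\<in>UNIV. (v $ i * v $ j) * gram s $ i $ j)"
    by (simp add: gram_nth int Bochner_Integration.integral_sum Bochner_Integration.integrable_sum)
  also have "\<dots> = v \<bullet> (gram s *v v)"
    by (simp add: inner_vec_def matrix_vector_mult_def sum_distrib_left mult_ac)
  finally show ?thesis by simp
qed

text \<open>For v in the kernel, the integral of the slice density times the square of
  \<open>u \<bullet> v\<close> vanishes. As the density is positive on the nonempty open set C, a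
  nonzero v would force C into the hyperplane orthogonal to v.\<close>

lemma invertible_gram:
  assumes s: "s \<in> {0..l}" and nd: "nondegenerate_slice K \<Gamma> l N s"
  shows "invertible (gram s)"
proof -
  obtain u where u: "0 < s" "s < l" "u \<in> slice s" "0 < jac s u" "nu s u \<in> interior K"
    using nondegenerate_regular_point[OF s nd] by blast
  obtain A where A: "open A" "(s, u) \<in> A"
    "\<And>z. z \<in> A \<Longrightarrow> snd z \<in> slice (fst z) \<and> nu (fst z) (snd z) \<in> interior K"
    using eventually_in_slice_interior[OF u] unfolding eventually_nhds by blast
  obtain B C where BC: "open B" "open C" "s \<in> B" "u \<in> C" "B \<times> C \<subseteq> A"
    using open_prod_elim[OF A(1,2)] by (metis mem_Sigma_iff)
  have pos: "0 < slice_density s w" if "w \<in> C" for w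
  proof -
    have "(s, w) \<in> A" using BC that by blast
    from A(3)[OF this] show ?thesis using p_pos_iff by (simp add: slice_density_def)
  qed
  have "v = 0" if v: "gram s *v v = 0" for v
  proof (rule ccontr)
    assume "v \<noteq> 0"
    have int: "integrable lborel (\<lambda>u. slice_density s u * (u \<bullet> v)\<^sup>2)"
      by (intro slice_density_integrable_mult[OF s] continuous_intros)
    have "(\<integral>u. slice_density s u * (u \<bullet> v)\<^sup>2 \<partial>lborel) = 0"
      using gram_quadratic[OF s, of v] v by simp
    then have "AE u in lborel. slice_density s u * (u \<bullet> v)\<^sup>2 = 0"
      using integral_nonneg_eq_0_iff_AE[OF int] slice_density_nonneg by simp
    then have "AE u in lborel. u \<notin> C - {u. v \<bullet> u = 0}"
    proof eventually_elim
      case (elim w)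
      then show ?case using pos[of w] by (auto simp: inner_commute)
    qed
    moreover have o: "open (C - {u. v \<bullet> u = 0})"
      using BC(2) closed_hyperplane[of v 0] by (rule open_Diff)
    ultimately have "C - {u. v \<bullet> u = 0} \<in> null_sets lborel"
      using AE_iff_null_sets[of "C - {u. v \<bullet> u = 0}" lborel] by simp
    then have "negligible (C - {u. v \<bullet> u = 0})"
      by (simp add: negligible_iff_null_sets null_sets_completionI)
    then have "C - {u. v \<bullet> u = 0} = {}" using open_not_negligible[OF o] by blast
    then have "C \<subseteq> {u. v \<bullet> u = 0}" by blast
    moreover have "negligible {u. v \<bullet> u = 0}" using \<open>v \<noteq> 0\<close> by (intro negligible_hyperplane) simp
    ultimately show False using negligible_subset open_not_negligible[OF BC(2)] BC(4) by blast
  qed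
  then have "\<exists>B. B ** gram s = mat 1" unfolding matrix_left_invertible_ker by blast
  then show ?thesis using invertible_left_inverse by blast
qed

end

section \<open>Self-consistency\<close>

text \<open>Conditional expectation given Y is characterised by integrals over the events that Y
  lies in B. \<open>\<Gamma>'\<close> is a Borel substitute for \<open>\<Gamma>\<close>, whose
  values off the interval are arbitrary, and acts as the version g in the converse.\<close>

lemma self_consistent_iff:
  assumes prob: "prob_space M" and X: "X \<in> borel_measurable M" and Y: "Y \<in> borel_measurable M"
    and Y_def: "\<And>w. Y w = projection_index \<Gamma> l (X w)"
    and int: "\<And>i. integrable M (\<lambda>w. X w $ i)"
    and \<Gamma>': "\<Gamma>' \<in> borel_measurable borel" "\<And>w. \<Gamma>' (Y w) = \<Gamma> (Y w)" "AE s in distr M borel Y. \<Gamma>' s = \<Gamma> s"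
    and int\<Gamma>: "\<And>i. integrable M (\<lambda>w. \<Gamma>' (Y w) $ i)"
  shows "self_consistent M X \<Gamma> l \<longleftrightarrow>
    (\<forall>B\<in>sets borel. \<forall>i. (\<integral>w. indicator B (Y w) * (X w $ i - \<Gamma> (Y w) $ i) \<partial>M) = 0)"
proof -
  interpret prob_space M by fact
  let ?F = "vimage_algebra (space M) Y borel"
  have sets_F: "sets ?F = {Y -` B \<inter> space M | B. B \<in> sets borel}"
    by (rule sets_vimage_algebra2) simp
  have sub: "subalgebra M ?F"
    using Y by (auto simp: subalgebra_def sets_F)
  interpret F: finite_measure_subalgebra M ?F by standard (rule sub)
  have sc: "self_consistent M X \<Gamma> l \<longleftrightarrow>
      (\<exists>g. g \<in> borel_measurable borel \<and> (\<forall>i. AE w in M. real_cond_exp M ?F (\<lambda>w. X w $ i) w = g (Y w) $ i) \<and>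
        (AE s in distr M borel Y. g s = \<Gamma> s))"
    unfolding self_consistent_def cond_exp_version_def Y_def[symmetric] by blast
  have set_int: "(\<integral>w\<in>Y -` B \<inter> space M. f w \<partial>M) = (\<integral>w. indicator B (Y w) * f w \<partial>M)" for B and f :: "_ \<Rightarrow> real"
    unfolding set_lebesgue_integral_def
    by (intro Bochner_Integration.integral_cong refl) (auto simp: indicator_def)
  have ind_int: "integrable M (\<lambda>w. indicator B (Y w) * f w)" if "integrable M f" "B \<in> sets borel" for B and f :: "_ \<Rightarrow> real"
  proof -
    have "integrable M (\<lambda>w. indicator (Y -` B \<inter> space M) w *\<^sub>R f w)"
      by (rule integrable_mult_indicator[OF measurable_sets[OF Y that(2)] that(1)])
    then show ?thesis
      by (rule Bochner_Integration.integrable_cong[THEN iffD1, rotated -1]) (auto simp: indicator_def)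
  qed
  have diff: "(\<integral>w. indicator B (Y w) * (X w $ i - \<Gamma> (Y w) $ i) \<partial>M) = 0 \<longleftrightarrow>
      (\<integral>w\<in>Y -` B \<inter> space M. X w $ i \<partial>M) = (\<integral>w\<in>Y -` B \<inter> space M. \<Gamma>' (Y w) $ i \<partial>M)"
    if "B \<in> sets borel" for B i
    unfolding set_int \<Gamma>'(2)[symmetric] right_diff_distrib
    using ind_int[OF int that] ind_int[OF int\<Gamma> that] by simp
  show ?thesis
  proof
    assume "self_consistent M X \<Gamma> l"
    then obtain g where g: "g \<in> borel_measurable borel"
      "\<And>i. AE w in M. real_cond_exp M ?F (\<lambda>w. X w $ i) w = g (Y w) $ i"
      "AE s in distr M borel Y. g s = \<Gamma> s"
      unfolding sc by blast
    have gY: "AE w in M. g (Y w) = \<Gamma> (Y w)" by (rule AE_distrD[OF Y g(3)])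
    show "\<forall>B\<in>sets borel. \<forall>i. (\<integral>w. indicator B (Y w) * (X w $ i - \<Gamma> (Y w) $ i) \<partial>M) = 0"
    proof (intro ballI allI)
      fix B :: "real set" and i assume B: "B \<in> sets borel"
      have "(\<integral>w\<in>Y -` B \<inter> space M. X w $ i \<partial>M) = (\<integral>w\<in>Y -` B \<inter> space M. real_cond_exp M ?F (\<lambda>w. X w $ i) w \<partial>M)"
        by (rule F.real_cond_exp_intA[OF int]) (use B sets_F in blast)
      also have "\<dots> = (\<integral>w\<in>Y -` B \<inter> space M. \<Gamma>' (Y w) $ i \<partial>M)"
        unfolding set_lebesgue_integral_def
      proof (rule integral_cong_AE)
        have A: "Y -` B \<inter> space M \<in> sets M" by (rule measurable_sets[OF Y B])
        show "(\<lambda>w. indicat_real (Y -` B \<inter> space M) w *\<^sub>R real_cond_exp M ?F (\<lambda>w. X w $ i) w) \<in> borel_measurable M"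
          using A borel_measurable_integrable[OF F.real_cond_exp_int(1)[OF int[of i]]] by measurable
        show "(\<lambda>w. indicat_real (Y -` B \<inter> space M) w *\<^sub>R \<Gamma>' (Y w) $ i) \<in> borel_measurable M"
          using A borel_measurable_integrable[OF int\<Gamma>[of i]] by measurable
        show "AE w in M. indicat_real (Y -` B \<inter> space M) w *\<^sub>R real_cond_exp M ?F (\<lambda>w. X w $ i) w =
            indicat_real (Y -` B \<inter> space M) w *\<^sub>R \<Gamma>' (Y w) $ i"
          using g(2)[of i] gY by eventually_elim (simp add: \<Gamma>'(2))
      qed
      finally show "(\<integral>w. indicator B (Y w) * (X w $ i - \<Gamma> (Y w) $ i) \<partial>M) = 0" unfolding diff[OF B] .
    qed
  next
    assume *: "\<forall>B\<in>sets borel. \<forall>i. (\<integral>w. indicator B (Y w) * (X w $ i - \<Gamma> (Y w) $ i) \<partial>M) = 0"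
    have "AE w in M. real_cond_exp M ?F (\<lambda>w. X w $ i) w = \<Gamma>' (Y w) $ i" for i
    proof (rule F.real_cond_exp_charact[OF _ int int\<Gamma>])
      fix A assume "A \<in> sets ?F"
      then obtain B where B: "B \<in> sets borel" "A = Y -` B \<inter> space M" unfolding sets_F by blast
      show "(\<integral>w\<in>A. X w $ i \<partial>M) = (\<integral>w\<in>A. \<Gamma>' (Y w) $ i \<partial>M)"
        using * B diff[OF B(1)] by blast
    next
      have "Y \<in> measurable ?F borel" by (rule measurable_vimage_algebra1) simp
      then have "(\<lambda>w. \<Gamma>' (Y w)) \<in> measurable ?F borel" by (rule measurable_compose[OF _ \<Gamma>'(1)])
      then show "(\<lambda>w. \<Gamma>' (Y w) $ i) \<in> borel_measurable ?F"
        by (rule measurable_compose) (intro borel_measurable_continuous_onI continuous_intros)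
    qed
    then show "self_consistent M X \<Gamma> l" unfolding sc using \<Gamma>'(1,3) by blast
  qed
qed

context density_along_curve
begin

lemma AE_interior_unambiguous:
  assumes X: "distributed M lborel X (\<lambda>x. ennreal (p x))"
  shows "AE w in M. X w \<in> interior K - amb"
proof -
  have Xm: "X \<in> measurable M lborel" using X by (simp add: distributed_def)
  have "AE x in density lborel (\<lambda>x. ennreal (p x)). x \<in> interior K - amb"
  proof (subst AE_density)
    show "AE x in lborel. 0 < ennreal (p x) \<longrightarrow> x \<in> interior K - amb"
      using AE_not_in[OF amb_null] by eventually_elim (auto simp: p_pos_iff)
  qed measurable
  then have "AE x in distr M lborel X. x \<in> interior K - amb"
    unfolding distributed_distr_eq_density[OF X] .
  then show ?thesis by (rule AE_distrD[OF Xm])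
qed

lemma nondegenerate_at_index:
  assumes "x \<in> interior K - amb"
  shows "nondegenerate_slice K \<Gamma> l N (index x)"
proof -
  have na: "x \<notin> amb" and "x \<in> K - amb" using assms interior_subset by blast+
  from in_nu_tube[OF na normal_at_index[OF this(2)]] obtain u where
    u: "(index x, u) \<in> tube" "x = nu (index x) u" by blast
  have "u \<in> slice (index x)" using u(1) by (simp add: tube_def)
  moreover have "nu (index x) u \<in> interior K" using assms unfolding u(2)[symmetric] by blast
  ultimately show ?thesis unfolding nondegenerate_slice_iff by blast
qed

text \<open>Almost surely X is unambiguous and interior to \<open>K\<close>, and then X itself shows
  that the slice at its index is nondegenerate.\<close>

lemma AE_invertible_gram:
  assumes X: "distributed M lborel X (\<lambda>x. ennreal (p x))"
  shows "AE s in distr M borel (\<lambda>w. index (X w)). invertible (gram s)"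
proof -
  have Xm: "X \<in> borel_measurable M" using X by (simp add: distributed_def)
  have Y: "(\<lambda>w. index (X w)) \<in> borel_measurable M" by (rule measurable_compose[OF Xm index_measurable])
  let ?D = "{s \<in> {0..l}. nondegenerate_slice K \<Gamma> l N s}"
  have "AE s in distr M borel (\<lambda>w. index (X w)). s \<in> ?D"
  proof (subst AE_distr_iff[OF Y])
    show "{s \<in> space borel. s \<in> ?D} \<in> sets borel" using borel_open[OF open_nondegenerate] by simp
    show "AE w in M. index (X w) \<in> ?D"
      using AE_interior_unambiguous[OF X] by eventually_elim (simp add: nondegenerate_at_index index_range del: atLeastAtMost_iff)
  qed
  then show ?thesis by eventually_elim (use invertible_gram in blast)
qed

text \<open>Pass to the law of X and then to normal coordinates. At \<open>nu s u\<close> the index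
  is s and the residual is \<open>offset s u\<close>, so the indicator of B leaves the inner
  integral, which is \<open>deviation s\<close>.\<close>

lemma integral_residual:
  assumes prob: "prob_space M" and X: "distributed M lborel X (\<lambda>x. ennreal (p x))" and B: "B \<in> sets borel"
  shows "integrable lborel (\<lambda>s. indicator (B \<inter> {0..l}) s *\<^sub>R deviation s)"
    and "(\<integral>w. indicator B (index (X w)) *\<^sub>R (X w - \<Gamma> (index (X w))) \<partial>M)
      = (\<integral>s. indicator (B \<inter> {0..l}) s *\<^sub>R deviation s \<partial>lborel)"
proof -
  interpret prob_space M by fact
  have Xm[measurable]: "X \<in> borel_measurable M" using X by (simp add: distributed_def)
  note [measurable] = B
  define f where "f x = indicator B (index x) *\<^sub>R (x - \<Gamma> (clamp_param (index x)))" for x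
  have [measurable]: "f \<in> borel_measurable borel" unfolding f_def by measurable
  have f_eq: "f x = indicator B (index x) *\<^sub>R (x - \<Gamma> (index x))" for x
    by (simp add: f_def clamp_param_id[OF index_range])
  obtain a where a: "\<And>x. x \<in> K \<Longrightarrow> norm x \<le> a"
    using K_bounded by blast
  obtain b where b: "\<And>s. s \<in> {0..l} \<Longrightarrow> norm (\<Gamma> s) \<le> b"
    using curve_bounded by blast
  have "integrable M (\<lambda>w. f (X w))"
  proof (rule integrable_const_bound)
    show "AE w in M. norm (f (X w)) \<le> a + b"
      using AE_interior_unambiguous[OF X]
    proof eventually_elim
      case (elim w)
      then have "norm (X w) \<le> a" using a interior_subset by blast
      moreover have "norm (\<Gamma> (index (X w))) \<le> b" by (rule b[OF index_range])
      moreover have "norm (f (X w)) \<le> norm (X w - \<Gamma> (index (X w)))"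
        by (auto simp: f_eq indicator_def)
      ultimately show ?case using norm_triangle_ineq4[of "X w" "\<Gamma> (index (X w))"] by linarith
    qed
  qed measurable
  then have "integrable (distr M lborel X) f" by (subst integrable_distr_eq) auto
  then have "integrable (density lborel (\<lambda>x. ennreal (p x))) f"
    using X by (simp add: distributed_distr_eq_density)
  then have int: "integrable lborel (\<lambda>x. p x *\<^sub>R f x)"
    by (subst (asm) integrable_density) (auto simp: p_nonneg)
  have "(\<integral>w. f (X w) \<partial>M) = integral\<^sup>L (distr M lborel X) f" by (subst integral_distr) auto
  also have "\<dots> = integral\<^sup>L (density lborel (\<lambda>x. ennreal (p x))) f"
    using X by (simp add: distributed_distr_eq_density)
  also have "\<dots> = (\<integral>x. p x *\<^sub>R f x \<partial>lborel)"
    by (rule integral_density) (auto simp: p_nonneg)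
  finally have 1: "(\<integral>w. f (X w) \<partial>M) = (\<integral>x. p x *\<^sub>R f x \<partial>lborel)" .
  have normal: "tangential x (index x) = 0" if "x \<notin> amb" "p x *\<^sub>R f x \<noteq> 0" for x
  proof -
    have "x \<in> interior K" using that p_eq_0[of x] by auto
    then show ?thesis using that interior_subset by (intro normal_at_index) blast
  qed
  have pull: "(\<integral>u. pullback (\<lambda>x. p x *\<^sub>R f x) (s, u) \<partial>lborel) = indicator (B \<inter> {0..l}) s *\<^sub>R deviation s" for s
  proof -
    have eq: "pullback (\<lambda>x. p x *\<^sub>R f x) (s, u)
        = indicator (B \<inter> {0..l}) s *\<^sub>R (slice_density s u *\<^sub>R (jac s u *\<^sub>R offset s u))" for u
    proof (cases "(s, u) \<in> tube")
      case True
      then have s: "s \<in> {0..l}" and u: "u \<in> slice s" by (auto simp: tube_def)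
      then have ix: "index (nu s u) = s" using closest_singletonD slice_iff by blast
      have "f (nu s u) = indicator B s *\<^sub>R offset s u" unfolding f_eq ix by (simp add: nu_def)
      then show ?thesis using True s u
        by (simp add: pullback_eq slice_density_def indicator_inter_arith mult_ac del: atLeastAtMost_iff)
    next
      case False
      then show ?thesis
        by (auto simp: pullback_eq slice_density_def indicator_def tube_def)
    qed
    show ?thesis unfolding eq deviation_def by (rule integral_scaleR_right)
  qed
  show "integrable lborel (\<lambda>s. indicator (B \<inter> {0..l}) s *\<^sub>R deviation s)"
    using integral_normal_coordinates(1)[OF int normal] unfolding pull .
  have 2: "(\<integral>x. p x *\<^sub>R f x \<partial>lborel)
      = (\<integral>s. (\<integral>u. pullback (\<lambda>x. p x *\<^sub>R f x) (s, u) \<partial>lborel) \<partial>lborel)"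
    by (rule integral_normal_coordinates(2)[OF int]) (rule normal)
  have "(\<integral>w. f (X w) \<partial>M) = (\<integral>s. indicator (B \<inter> {0..l}) s *\<^sub>R deviation s \<partial>lborel)"
    unfolding 1 2 pull ..
  then show "(\<integral>w. indicator B (index (X w)) *\<^sub>R (X w - \<Gamma> (index (X w))) \<partial>M)
      = (\<integral>s. indicator (B \<inter> {0..l}) s *\<^sub>R deviation s \<partial>lborel)"
    unfolding f_eq .
qed

text \<open>Vanishing integrals over all Borel sets give zero almost everywhere, coordinate by
  coordinate. A continuous function on the open interval that is nonzero somewhere is nonzero on a
  non-null open set; the end points are treated apart.\<close>

lemma deviation_zero:
  assumes int: "integrable lborel (\<lambda>s. indicator {0..l} s *\<^sub>R deviation s)"
    and zero: "\<And>B. B \<in> sets borel \<Longrightarrow> (\<integral>s. indicator (B \<inter> {0..l}) s *\<^sub>R deviation s \<partial>lborel) = 0"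
    and s: "s \<in> {0..l}"
  shows "deviation s = 0"
proof (cases "s = 0 \<or> s = l")
  case False
  then have s': "s \<in> {0<..<l}" using s by auto
  have "deviation s $ i = 0" for i
  proof (rule ccontr)
    assume nz: "deviation s $ i \<noteq> 0"
    define h where "h t = (indicator {0..l} t *\<^sub>R deviation t) $ i" for t
    have h_int: "integrable lborel h"
      unfolding h_def using integrable_bounded_linear[OF bounded_linear_vec_nth int] .
    then have [measurable]: "h \<in> borel_measurable borel" by auto
    have hB: "(\<integral>t. indicator B t * h t \<partial>lborel) = 0" "integrable lborel (\<lambda>t. indicator B t * h t)" if B: "B \<in> sets borel" for B
    proof -
      have eq: "indicator B t * h t = (indicator (B \<inter> {0..l}) t *\<^sub>R deviation t) $ i" for t
        by (simp add: h_def indicator_inter_arith)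
      have I: "integrable lborel (\<lambda>t. indicator B t *\<^sub>R (indicator {0..l} t *\<^sub>R deviation t))"
        using integrable_mult_indicator[OF _ int, of B] B by simp
      then have I: "integrable lborel (\<lambda>t. indicator (B \<inter> {0..l}) t *\<^sub>R deviation t)"
        by (simp add: indicator_inter_arith)
      show "(\<integral>t. indicator B t * h t \<partial>lborel) = 0"
        unfolding eq integral_bounded_linear[OF bounded_linear_vec_nth I] zero[OF B] by simp
      show "integrable lborel (\<lambda>t. indicator B t * h t)"
        unfolding eq by (rule integrable_bounded_linear[OF bounded_linear_vec_nth I])
    qed
    \<comment> \<open>Taking B as the set where h is positive, then where it is negative, makes the
      integrand of one sign.\<close>
    have "AE t in lborel. indicator {t. h t > 0} t * h t = 0"
      using hB[of "{t. h t > 0}"] by (subst integral_nonneg_eq_0_iff_AE[symmetric]) (auto simp: indicator_def)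
    moreover have "AE t in lborel. - (indicator {t. h t < 0} t * h t) = 0"
      using hB[of "{t. h t < 0}"] by (subst integral_nonneg_eq_0_iff_AE[symmetric]) (auto simp: indicator_def)
    ultimately have "AE t in lborel. h t = 0"
    proof eventually_elim
      case (elim t)
      then show ?case by (cases "h t > 0"; cases "h t < 0") auto
    qed
    define Z where "Z = {t \<in> {0<..<l}. deviation t $ i \<noteq> 0}"
    have "continuous_on {0<..<l} (\<lambda>t. deviation t $ i)" by (intro continuous_intros cont_deviation)
    from continuous_open_preimage[OF this open_greaterThanLessThan open_Compl[OF closed_singleton]]
    have "open ({0<..<l} \<inter> (\<lambda>t. deviation t $ i) -` (- {0}))" .
    moreover have "{0<..<l} \<inter> (\<lambda>t. deviation t $ i) -` (- {0}) = Z" by (auto simp: Z_def)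
    ultimately have Z: "open Z" by simp
    have "AE t in lborel. t \<notin> Z"
      using \<open>AE t in lborel. h t = 0\<close> by eventually_elim (auto simp: Z_def h_def)
    then have "Z \<in> null_sets lborel" using Z AE_iff_null_sets[of Z lborel] by simp
    then have "negligible Z" by (simp add: negligible_iff_null_sets null_sets_completionI)
    then have "Z = {}" using open_not_negligible[OF Z] by blast
    then show False using nz s' by (auto simp: Z_def)
  qed
  then show ?thesis by (simp add: vec_eq_iff)
qed (rule deviation_endpoint)

lemma self_consistent_iff_moments:
  assumes prob: "prob_space M" and X: "distributed M lborel X (\<lambda>x. ennreal (p x))"
  shows "self_consistent M X \<Gamma> l \<longleftrightarrow> (\<forall>s\<in>{0..l}. mom s = gram s *v kappa s)"
proof -
  interpret prob_space M by fact
  have Xm[measurable]: "X \<in> borel_measurable M" using X by (simp add: distributed_def)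
  have Ym[measurable]: "(\<lambda>w. index (X w)) \<in> borel_measurable M" by (rule measurable_compose[OF Xm index_measurable])
  obtain a where a: "\<And>x. x \<in> K \<Longrightarrow> norm x \<le> a"
    using K_bounded by blast
  obtain b where b: "\<And>s. s \<in> {0..l} \<Longrightarrow> norm (\<Gamma> s) \<le> b"
    using curve_bounded by blast
  have intX: "integrable M X"
  proof (rule integrable_const_bound)
    show "AE w in M. norm (X w) \<le> a"
      using AE_interior_unambiguous[OF X] by eventually_elim (use a interior_subset in blast)
  qed measurable
  have int\<Gamma>: "integrable M (\<lambda>w. \<Gamma> (clamp_param (index (X w))))"
    by (rule integrable_const_bound[where B = b]) (auto intro!: b clamp_param_range)
  have i1: "integrable M (\<lambda>w. X w $ i)" "integrable M (\<lambda>w. \<Gamma> (clamp_param (index (X w))) $ i)" for i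
    using integrable_bounded_linear[OF bounded_linear_vec_nth intX]
      integrable_bounded_linear[OF bounded_linear_vec_nth int\<Gamma>] by auto
  have AE_range: "AE s in distr M borel (\<lambda>w. index (X w)). s \<in> {0..l}"
    by (subst AE_distr_iff[OF Ym]) (use index_range in auto)
  have sc: "self_consistent M X \<Gamma> l \<longleftrightarrow>
    (\<forall>B\<in>sets borel. \<forall>i. (\<integral>w. indicator B (index (X w)) * (X w $ i - \<Gamma> (index (X w)) $ i) \<partial>M) = 0)"
  proof (rule self_consistent_iff[OF prob Xm Ym refl i1(1) curve_clamp_measurable _ _ i1(2)])
    show "AE s in distr M borel (\<lambda>w. index (X w)). \<Gamma> (clamp_param s) = \<Gamma> s"
      using AE_range by eventually_elim (simp add: clamp_param_id del: atLeastAtMost_iff)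
    show "\<Gamma> (clamp_param (index (X w))) = \<Gamma> (index (X w))" for w
      by (simp add: clamp_param_id[OF index_range])
  qed
  have vec: "(\<forall>i. (\<integral>w. indicator B (index (X w)) * (X w $ i - \<Gamma> (index (X w)) $ i) \<partial>M) = 0) \<longleftrightarrow>
      (\<integral>s. indicator (B \<inter> {0..l}) s *\<^sub>R deviation s \<partial>lborel) = 0" if B: "B \<in> sets borel" for B
  proof -
    note [measurable] = B
    have "integrable M (\<lambda>w. X w - \<Gamma> (clamp_param (index (X w))))" using intX int\<Gamma> by simp
    then have "integrable M (\<lambda>w. indicator ((\<lambda>w. index (X w)) -` B \<inter> space M) w *\<^sub>R (X w - \<Gamma> (clamp_param (index (X w)))))"
      by (rule integrable_mult_indicator[OF measurable_sets[OF Ym B]])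
    then have I: "integrable M (\<lambda>w. indicator B (index (X w)) *\<^sub>R (X w - \<Gamma> (index (X w))))"
      by (rule Bochner_Integration.integrable_cong[THEN iffD1, rotated -1])
         (auto simp: indicator_def clamp_param_id[OF index_range])
    have "(\<integral>w. indicator B (index (X w)) * (X w $ i - \<Gamma> (index (X w)) $ i) \<partial>M)
        = (\<integral>w. indicator B (index (X w)) *\<^sub>R (X w - \<Gamma> (index (X w))) \<partial>M) $ i" for i
      unfolding integral_bounded_linear[OF bounded_linear_vec_nth I, symmetric] by simp
    then show ?thesis unfolding integral_residual(2)[OF prob X B] by (simp add: vec_eq_iff)
  qed
  have "self_consistent M X \<Gamma> l \<longleftrightarrow>
      (\<forall>B\<in>sets borel. (\<integral>s. indicator (B \<inter> {0..l}) s *\<^sub>R deviation s \<partial>lborel) = 0)"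
    unfolding sc using vec by blast
  also have "\<dots> \<longleftrightarrow> (\<forall>s\<in>{0..l}. deviation s = 0)"
  proof
    assume "\<forall>B\<in>sets borel. (\<integral>s. indicator (B \<inter> {0..l}) s *\<^sub>R deviation s \<partial>lborel) = 0"
    then show "\<forall>s\<in>{0..l}. deviation s = 0"
      using deviation_zero integral_residual(1)[OF prob X, of UNIV] by simp
  next
    assume z: "\<forall>s\<in>{0..l}. deviation s = 0"
    have "indicator (B \<inter> {0..l}) s *\<^sub>R deviation s = 0" for B s using z by (auto simp: indicator_def)
    then show "\<forall>B\<in>sets borel. (\<integral>s. indicator (B \<inter> {0..l}) s *\<^sub>R deviation s \<partial>lborel) = 0"
      by (simp only: integral_zero) simp
  qed
  also have "\<dots> \<longleftrightarrow> (\<forall>s\<in>{0..l}. mom s = gram s *v kappa s)" using deviation_eq_0_iff by simp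
  finally show ?thesis .
qed

end

section \<open>From smooth curves and frames to the locale assumptions\<close>

lemma smooth_path_derivative:
  fixes f :: "real \<Rightarrow> 'a::euclidean_space"
  assumes l: "0 < l" and f: "smooth_path l f"
  defines "f' \<equiv> \<lambda>s. vector_derivative f (at s within {0..l})"
  shows "\<And>s. s \<in> {0..l} \<Longrightarrow> (f has_vector_derivative f' s) (at s within {0..l})" and "smooth_path l f'"
proof -
  obtain D where D: "D 0 = f"
    "\<And>k s. s \<in> {0..l} \<Longrightarrow> (D k has_vector_derivative D (Suc k) s) (at s within {0..l})"
    using f unfolding smooth_path_def by blast
  have eq: "f' s = D 1 s" if "s \<in> {0..l}" for s
    unfolding f'_def using D(2)[OF that, of 0] that l
    by (intro vector_derivative_within_closed_interval) (auto simp: D(1))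
  show "(f has_vector_derivative f' s) (at s within {0..l})" if "s \<in> {0..l}" for s
    using D(2)[OF that, of 0] eq[OF that] by (simp add: D(1))
  \<comment> \<open>\<open>D 1\<close> is known to agree with \<open>f'\<close> only on
    \<open>{0..l}\<close>, whereas a derivative sequence must start with the function itself, so the
    shifted sequence has \<open>f'\<close> in place of \<open>D 1\<close>.\<close>
  have "((case k of 0 \<Rightarrow> f' | Suc m \<Rightarrow> D (Suc k)) has_vector_derivative D (Suc (Suc k)) s) (at s within {0..l})"
    if s: "s \<in> {0..l}" for k s
  proof (cases k)
    case 0
    have "(f' has_vector_derivative D (Suc (Suc 0)) s) (at s within {0..l})"
      by (rule has_vector_derivative_transform[OF s _ D(2)[OF s, of 1, unfolded One_nat_def]]) (simp add: eq)
    then show ?thesis using 0 by simp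
  qed (use D(2)[OF s, of "Suc k"] in simp)
  then show "smooth_path l f'"
    unfolding smooth_path_def
    by (intro exI[of _ "\<lambda>k. case k of 0 \<Rightarrow> f' | Suc m \<Rightarrow> D (Suc k)"]) simp
qed

lemma smooth_path_continuous:
  fixes f :: "real \<Rightarrow> 'a::euclidean_space"
  assumes "0 < l" "smooth_path l f" shows "continuous_on {0..l} f"
  using smooth_path_derivative(1)[OF assms] has_vector_derivative_continuous
  unfolding continuous_on_eq_continuous_within by blast

lemma smooth_continuous: "smooth f \<Longrightarrow> continuous_on UNIV f"
  unfolding smooth_def by (drule spec[of _ 0]) simp

lemma framed_curve_intro:
  fixes N :: "'n::finite \<Rightarrow> real \<Rightarrow> real ^ 'd"
  assumes dim: "CARD('d) \<ge> 2" "CARD('n) = CARD('d) - 1"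
    and curve: "smooth_jordan_curve \<Gamma> l"
    and frame: "moving_frame \<Gamma> l N"
  shows "framed_curve \<Gamma> (unit_tangent \<Gamma> l)
    (\<lambda>s. vector_derivative (unit_tangent \<Gamma> l) (at s within {0..l})) l N
    (\<lambda>i s. vector_derivative (N i) (at s within {0..l}))"
proof
  have l: "0 < l" and \<Gamma>: "smooth_path l \<Gamma>" using curve by (auto simp: smooth_jordan_curve_def)
  have T: "smooth_path l (unit_tangent \<Gamma> l)"
    using smooth_path_derivative(2)[OF l \<Gamma>] by (simp add: unit_tangent_def[abs_def])
  have N: "smooth_path l (N i)" for i using frame by (auto simp: moving_frame_def)
  have sp: "span (range (\<lambda>i. N i s)) = {v. v \<bullet> unit_tangent \<Gamma> l s = 0}" if "s \<in> {0..l}" for s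
    using frame that by (auto simp only: moving_frame_def)
  show "0 < l" by (rule l)
  show "inj_on \<Gamma> {0..l}" using curve by (simp add: smooth_jordan_curve_def)
  show "CARD('d) = Suc CARD('n)" using dim by simp
  show "continuous_on {0..l} (\<lambda>s. vector_derivative (unit_tangent \<Gamma> l) (at s within {0..l}))"
    by (rule smooth_path_continuous[OF l smooth_path_derivative(2)[OF l T]])
  fix s assume s: "s \<in> {0..l}"
  show "(\<Gamma> has_vector_derivative unit_tangent \<Gamma> l s) (at s within {0..l})"
    using smooth_path_derivative(1)[OF l \<Gamma> s] by (simp add: unit_tangent_def)
  show "(unit_tangent \<Gamma> l has_vector_derivative vector_derivative (unit_tangent \<Gamma> l) (at s within {0..l}))
      (at s within {0..l})"
    by (rule smooth_path_derivative(1)[OF l T s])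
  show "(N i has_vector_derivative vector_derivative (N i) (at s within {0..l})) (at s within {0..l})" for i
    by (rule smooth_path_derivative(1)[OF l N s])
  show "norm (unit_tangent \<Gamma> l s) = 1" using curve s by (simp add: smooth_jordan_curve_def)
  show "norm (N i s) = 1" for i using frame s by (simp add: moving_frame_def)
  show "N i s \<bullet> N j s = 0" if "i \<noteq> j" for i j using frame s that by (simp add: moving_frame_def)
  show "N i s \<bullet> unit_tangent \<Gamma> l s = 0" for i
    using sp[OF s] span_base[of "N i s" "range (\<lambda>i. N i s)"] by auto
  show "v \<in> span (range (\<lambda>i. N i s))" if "v \<bullet> unit_tangent \<Gamma> l s = 0" for v
    unfolding sp[OF s] using that by simp
qed

text \<open>Invertibility is claimed at parameters with a nondegenerate slice; by the last conjunct
  the parameters with a singular Gram matrix are null for the distribution of the projection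
  index.\<close>

theorem theorem4p1:
  fixes M :: "'w measure"
    and X :: "'w \<Rightarrow> real ^ 'd"
    and p :: "real ^ 'd \<Rightarrow> real"
    and K :: "(real ^ 'd) set"
    and \<Gamma> :: "real \<Rightarrow> real ^ 'd"
    and l :: real
    and N :: "'n::finite \<Rightarrow> real \<Rightarrow> real ^ 'd"
  assumes dim: "CARD('d) \<ge> 2" "CARD('n) = CARD('d) - 1"
    and prob: "prob_space M"
    and density: "distributed M lborel X (\<lambda>x. ennreal (p x))" "\<And>x. 0 \<le> p x" "smooth p"
    and supp: "support p = K" "compact_region K" "\<And>x. x \<in> interior K \<Longrightarrow> 0 < p x"
    and curve: "smooth_jordan_curve \<Gamma> l" "\<Gamma> ` {0..l} \<subseteq> K"
    and frame: "moving_frame \<Gamma> l N"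
    and diffeo: "normal_coords_diffeo_on \<Gamma> l N
                   ((projection_index \<Gamma> l -` {0..l} \<inter> K) - ambiguity_points \<Gamma> l)"
  shows "(self_consistent M X \<Gamma> l \<longleftrightarrow>
            (\<forall>s\<in>{0..l}. moment_vector p \<Gamma> l N s
                          = gram_matrix p \<Gamma> l N s *v principal_curvatures \<Gamma> l N s))
       \<and> (\<forall>s\<in>{0..l}. nondegenerate_slice K \<Gamma> l N s \<longrightarrow>
            invertible (gram_matrix p \<Gamma> l N s) \<and>
            (moment_vector p \<Gamma> l N s = gram_matrix p \<Gamma> l N s *v principal_curvatures \<Gamma> l N s
               \<longleftrightarrow> principal_curvatures \<Gamma> l N s
                     = matrix_inv (gram_matrix p \<Gamma> l N s) *v moment_vector p \<Gamma> l N s))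
       \<and> (AE s in distr M borel (\<lambda>w. projection_index \<Gamma> l (X w)).
            invertible (gram_matrix p \<Gamma> l N s))"
proof -
  let ?T = "unit_tangent \<Gamma> l"
  let ?dT = "\<lambda>s. vector_derivative ?T (at s within {0..l})"
  let ?dN = "\<lambda>i s. vector_derivative (N i) (at s within {0..l})"
  interpret framed_curve \<Gamma> ?T ?dT l N ?dN
    by (rule framed_curve_intro[OF dim curve(1) frame])
  have cont_p: "continuous_on UNIV p" using density(3) by (rule smooth_continuous)
  interpret density_along_curve \<Gamma> ?T ?dT l N ?dN p K
  proof
    show "continuous_on UNIV p" by (rule cont_p)
    show "0 \<le> p x" for x by (rule density(2))
    show "compact K" using supp(2) by (simp add: compact_region_def)
    \<comment> \<open>The nonvanishing set of p is open and contained in its support, hence in the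
      interior of \<open>K\<close>. This is the converse of the assumed positivity.\<close>
    have "open (p -` (- {0}))" by (rule open_vimage[OF open_Compl[OF closed_singleton] cont_p])
    also have "p -` (- {0}) = {x. p x \<noteq> 0}" by (simp add: vimage_def)
    finally have "open {x. p x \<noteq> 0}" .
    moreover have "{x. p x \<noteq> 0} \<subseteq> K"
      unfolding supp(1)[symmetric] support_def by (rule closure_subset)
    ultimately have "{x. p x \<noteq> 0} \<subseteq> interior K" by (rule interior_maximal[rotated])
    then show "0 < p x \<longleftrightarrow> x \<in> interior K" for x using supp(3)[of x] less_irrefl[of "0 :: real"] by force
    show "tangential x (index x) = 0" if "x \<in> K - amb" for x
    proof -
      have "x \<in> (index -` {0..l} \<inter> K) - amb" using that index_range[of x] by blast
      then have "normal_coord_map \<Gamma> N (normal_coord_transform \<Gamma> l N x) = x"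
        using diffeo unfolding normal_coords_diffeo_on_def by blast
      \<comment> \<open>The identity exhibits x as a point of the normal space at its index, whether
        or not that index is an end point.\<close>
      then have "nu (index x) (snd (normal_coord_transform \<Gamma> l N x)) = x"
        unfolding normal_coord_transform_def normal_coord_map_nu by simp
      then show ?thesis using tangential_nu[OF index_range] by metis
    qed
  qed
  have "kappa s = principal_curvatures \<Gamma> l N s" for s
    by (simp add: kappa_def principal_curvatures_def)
  note [simp] = this
  have "self_consistent M X \<Gamma> l \<longleftrightarrow>
      (\<forall>s\<in>{0..l}. mom s = gram s *v principal_curvatures \<Gamma> l N s)"
    using self_consistent_iff_moments[OF prob density(1)] by simp
  then show ?thesis
    using invertible_gram invertible_solve AE_invertible_gram[OF density(1)] by blast
qed

end
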